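(* Let $C\subseteq\mathbb R$ be homeomorphic to the Cantor space and algebraically independent over $\mathbb Q$, and identify $\overline{\mathbb N}^{\uparrow\mathbb N}$ with $C$ via a fixed homeomorphism. Let $\mathcal F$ be a filter, let $S=\{f_\alpha:\alpha<\mathfrak b(\mathcal F)\}$ be a $\mathfrak b(\mathcal F)$-scale, and let $X=S\cup Q\subseteq\overline{\mathbb N}^{\uparrow\mathbb N}=C\subseteq\mathbb R$. Let $\mathbb Q(X)$ be the subfield of $\mathbb R$ generated by $\mathbb Q\cup X$. Then: (1) All finite powers of $\mathbb Q(X)$ satisfy $\mathbf B(\mathcal F^+)$. (2) If $\mathcal F$ is an ultrafilter, then all finite powers of $\mathbb Q(X)$ satisfy $\mathbf B(\mathcal F)$. (3) If $\mathcal F$ is a feeble filter, then all finite powers of $\mathbb Q(X)$ have the Hurewicz property. On the other hand, (4) For each property $P$ of sets of reals which is hereditary for closed subsets, if $X$ does not have the property $P$, then $\mathbb Q(X)$ does not have the property $P$ either. (5) $\mathbb Q(X)$ is not $\sigma$-compact.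
   Context: $\mathbb N=\{0,1,2,\dots\}$, discrete; $\mathbb N^{\mathbb N}$ has the product topology. $[\mathbb N]^{\aleph_0}$ is the family of infinite subsets of $\mathbb N$; $A\subseteq^*B$ means $A\setminus B$ is finite. A semifilter is a nonempty $\mathcal F\subseteq[\mathbb N]^{\aleph_0}$ such that $A\in\mathcal F$, $B\subseteq\mathbb N$ and $A\subseteq^*B$ imply $B\in\mathcal F$. A filter is a semifilter closed under finite intersections; an ultrafilter is a maximal filter (hence nonprincipal). $\mathcal F^+=\{A\subseteq\mathbb N:\mathbb N\setminus A\notin\mathcal F\}$. For $f,g\in\mathbb N^{\mathbb N}$, $f\le_{\mathcal F}g$ means $\{n:f(n)\le g(n)\}\in\mathcal F$, and $f\le^*g$ means $f(n)\le g(n)$ for all but finitely many $n$. A set $Y\subseteq\mathbb N^{\mathbb N}$ is bounded with respect to such a relation $R$ if there is $g\in\mathbb N^{\mathbb N}$ with $f\,R\,g$ for all $f\in Y$; otherwise it is unbounded. $\mathfrak b(\mathcal F)$ is the minimal cardinality of a subset of $\mathbb N^{\mathbb N}$ unbounded with respect to $\le_{\mathcal F}$. A space satisfies $\mathbf B(\mathcal F)$ if each of its continuous images in $\mathbb N^{\mathbb N}$ is bounded with respect to $\le_{\mathcal F}$; it has the Hurewicz property if each of its continuous images in $\mathbb N^{\mathbb N}$ is bounded with respect to $\le^*$. $\mathbb N^{\uparrow\mathbb N}$ is the set of (strictly) increasing elements of $\mathbb N^{\mathbb N}$. A family $\mathcal F\subseteq[\mathbb N]^{\aleph_0}$ is feeble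 if there is $h\in\mathbb N^{\uparrow\mathbb N}$ such that for each $A\in\mathcal F$, $A\cap[h(n),h(n+1))\ne\emptyset$ for all but finitely many $n$. A $\mathfrak b(\mathcal F)$-scale is a family $S=\{f_\alpha:\alpha<\mathfrak b(\mathcal F)\}\subseteq\mathbb N^{\uparrow\mathbb N}$ that is unbounded with respect to $\le_{\mathcal F}$ and satisfies $f_\alpha\le_{\mathcal F}f_\beta$ for all $\alpha<\beta<\mathfrak b(\mathcal F)$. $\overline{\mathbb N}=\mathbb N\cup\{\infty\}$ is the one-point compactification of $\mathbb N$. $\overline{\mathbb N}^{\uparrow\mathbb N}$ is the subspace of the product $\overline{\mathbb N}^{\mathbb N}$ consisting of the nondecreasing $f$ such that $f(n)<f(n+1)$ whenever $f(n)<\infty$; it is homeomorphic to the Cantor space. $Q$ (not to be confused with the rationals $\mathbb Q$) is the countable set of all $f\in\overline{\mathbb N}^{\uparrow\mathbb N}$ that take the value $\infty$; thus $\overline{\mathbb N}^{\uparrow\mathbb N}=Q\cup\mathbb N^{\uparrow\mathbb N}$. A set $C$ as in the claim exists by a classical theorem of von Neumann. A property $P$ is hereditary for closed subsets if every relatively closed subset of a set of reals with property $P$ has property $P$. *)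

theory Defs
  imports "HOL-Analysis.Analysis" "HOL-Library.Poly_Mapping"
begin

section \<open>Semifilters and filters on the natural numbers\<close>

definition almost_subset :: "nat set \<Rightarrow> nat set \<Rightarrow> bool" where
  "almost_subset A B \<longleftrightarrow> finite (A - B)"

definition is_semifilter :: "nat set set \<Rightarrow> bool" where
  "is_semifilter F \<longleftrightarrow> F \<noteq> {} \<and> (\<forall>A\<in>F. infinite A) \<and>
     (\<forall>A\<in>F. \<forall>B. almost_subset A B \<longrightarrow> B \<in> F)"

definition is_filter_nat :: "nat set set \<Rightarrow> bool" where
  "is_filter_nat F \<longleftrightarrow> is_semifilter F \<and> (\<forall>A\<in>F. \<forall>B\<in>F. A \<inter> B \<in> F)"

definition is_ultrafilter_nat :: "nat set set \<Rightarrow> bool" where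
  "is_ultrafilter_nat F \<longleftrightarrow> is_filter_nat F \<and> (\<forall>G. is_filter_nat G \<and> F \<subseteq> G \<longrightarrow> G = F)"

definition positive_sets :: "nat set set \<Rightarrow> nat set set" where
  "positive_sets F = {A. - A \<notin> F}"

definition feeble :: "nat set set \<Rightarrow> bool" where
  "feeble F \<longleftrightarrow> (\<forall>A\<in>F. infinite A) \<and>
     (\<exists>h :: nat \<Rightarrow> nat. strict_mono h \<and>
        (\<forall>A\<in>F. \<forall>\<^sub>F n in sequentially. A \<inter> {h n..<h (Suc n)} \<noteq> {}))"


section \<open>Boundedness and scales\<close>

definition le_mod :: "nat set set \<Rightarrow> (nat \<Rightarrow> nat) \<Rightarrow> (nat \<Rightarrow> nat) \<Rightarrow> bool" where
  "le_mod F f g \<longleftrightarrow> {n. f n \<le> g n} \<in> F"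

definition le_star :: "(nat \<Rightarrow> nat) \<Rightarrow> (nat \<Rightarrow> nat) \<Rightarrow> bool" where
  "le_star f g \<longleftrightarrow> (\<forall>\<^sub>F n in sequentially. f n \<le> g n)"

definition bounded_wrt :: "((nat \<Rightarrow> nat) \<Rightarrow> (nat \<Rightarrow> nat) \<Rightarrow> bool) \<Rightarrow> (nat \<Rightarrow> nat) set \<Rightarrow> bool" where
  "bounded_wrt R Y \<longleftrightarrow> (\<exists>g. \<forall>f\<in>Y. R f g)"

context
  includes cardinal_syntax
begin

text \<open>
  The cardinal number \<open>\<bb>(F)\<close> is represented, as usual in HOL, by a well-order of minimal
  order type, namely \<open>|Y|\<close> for an unbounded set \<open>Y\<close> of least cardinality.  The ordinals below
  \<open>\<bb>(F)\<close> are the elements of the field of this well-order.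
\<close>
definition b_number :: "nat set set \<Rightarrow> (nat \<Rightarrow> nat) rel" where
  "b_number F = |SOME Y. \<not> bounded_wrt (le_mod F) Y \<and>
                    (\<forall>Z. \<not> bounded_wrt (le_mod F) Z \<longrightarrow> |Y| \<le>o |Z| )|"

lemma not_bounded_UNIV:
  assumes "is_semifilter F"
  shows "\<not> bounded_wrt (le_mod F) UNIV"
proof
  assume "bounded_wrt (le_mod F) UNIV"
  then obtain g where "\<And>f. le_mod F f g"
    by (auto simp: bounded_wrt_def)
  from this[of "\<lambda>n. Suc (g n)"] have "{} \<in> F"
    by (simp add: le_mod_def)
  with assms show False
    by (auto simp: is_semifilter_def)
qed

lemma b_number_minimal:
  assumes "is_semifilter F"
  shows "\<exists>Y. b_number F = |Y| \<and> \<not> bounded_wrt (le_mod F) Y \<and>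
           (\<forall>Z. \<not> bounded_wrt (le_mod F) Z \<longrightarrow> |Y| \<le>o |Z| )"
proof -
  let ?R = "card_of ` {Y. \<not> bounded_wrt (le_mod F) Y}"
  have "?R \<noteq> {}"
    using not_bounded_UNIV[OF assms] by blast
  moreover have "\<forall>r\<in>?R. Well_order r"
    by (auto intro: card_of_Well_order)
  ultimately have "\<exists>r\<in>?R. \<forall>r'\<in>?R. r \<le>o r'"
    by (rule exists_minim_Well_order)
  then have "\<exists>Y. \<not> bounded_wrt (le_mod F) Y \<and>
               (\<forall>Z. \<not> bounded_wrt (le_mod F) Z \<longrightarrow> |Y| \<le>o |Z| )"
    by auto
  from someI_ex[OF this] show ?thesis
    unfolding b_number_def by blast
qed

end

definition is_b_scale :: "nat set set \<Rightarrow> (nat \<Rightarrow> nat) set \<Rightarrow> bool" where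
  "is_b_scale F S \<longleftrightarrow>
     (\<forall>f\<in>S. strict_mono f) \<and> \<not> bounded_wrt (le_mod F) S \<and>
     (\<exists>f. S = f ` Field (b_number F) \<and>
          (\<forall>\<alpha> \<beta>. (\<alpha>, \<beta>) \<in> b_number F \<and> \<alpha> \<noteq> \<beta> \<longrightarrow> le_mod F (f \<alpha>) (f \<beta>)))"


section \<open>Covering properties of spaces\<close>

text \<open>The type \<^typ>\<open>nat \<Rightarrow> nat\<close> carries the product topology of discrete spaces.\<close>

definition satisfies_B :: "nat set set \<Rightarrow> 'a topology \<Rightarrow> bool" where
  "satisfies_B F T \<longleftrightarrow>
     (\<forall>\<Psi> :: 'a \<Rightarrow> nat \<Rightarrow> nat. continuous_map T euclidean \<Psi> \<longrightarrow>
        bounded_wrt (le_mod F) (\<Psi> ` topspace T))"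

definition hurewicz :: "'a topology \<Rightarrow> bool" where
  "hurewicz T \<longleftrightarrow>
     (\<forall>\<Psi> :: 'a \<Rightarrow> nat \<Rightarrow> nat. continuous_map T euclidean \<Psi> \<longrightarrow>
        bounded_wrt le_star (\<Psi> ` topspace T))"

definition finite_power :: "nat \<Rightarrow> real set \<Rightarrow> (nat \<Rightarrow> real) topology" where
  "finite_power k K = product_topology (\<lambda>_. top_of_set K) {..<k}"

definition sigma_compact :: "real set \<Rightarrow> bool" where
  "sigma_compact K \<longleftrightarrow> (\<exists>A :: nat \<Rightarrow> real set. (\<forall>n. compact (A n)) \<and> K = (\<Union>n. A n))"

definition hereditary_closed :: "(real set \<Rightarrow> bool) \<Rightarrow> bool" where
  "hereditary_closed P \<longleftrightarrow> (\<forall>A B. P A \<and> closedin (top_of_set A) B \<longrightarrow> P B)"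


section \<open>Increasing sequences with values in the compactified naturals\<close>

text \<open>
  The order topology of \<^typ>\<open>enat\<close> is the topology of the one-point compactification of the
  discrete space of natural numbers, and \<^typ>\<open>nat \<Rightarrow> enat\<close> carries the product topology.
\<close>

definition ext_incr :: "(nat \<Rightarrow> enat) set" where
  "ext_incr = {f. mono f \<and> (\<forall>n. f n < \<infinity> \<longrightarrow> f n < f (Suc n))}"

definition ext_incr_inf :: "(nat \<Rightarrow> enat) set" where
  "ext_incr_inf = {f \<in> ext_incr. \<exists>n. f n = \<infinity>}"

definition ext_embed :: "(nat \<Rightarrow> nat) \<Rightarrow> nat \<Rightarrow> enat" where
  "ext_embed f = (\<lambda>n. enat (f n))"


section \<open>Fields generated by sets of reals and algebraic independence\<close>

definition is_subfield :: "real set \<Rightarrow> bool" where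
  "is_subfield K \<longleftrightarrow> 0 \<in> K \<and> 1 \<in> K \<and>
     (\<forall>x\<in>K. \<forall>y\<in>K. x + y \<in> K \<and> x * y \<in> K) \<and>
     (\<forall>x\<in>K. - x \<in> K \<and> inverse x \<in> K)"

definition gen_field :: "real set \<Rightarrow> real set" where
  "gen_field X = is_subfield hull (\<rat> \<union> X)"

text \<open>
  A polynomial with rational coefficients, whose indeterminates are indexed by real numbers, is
  a finitely supported map from monomials to \<^typ>\<open>rat\<close>; a monomial is a finitely supported map
  from indeterminates to exponents.  The function below evaluates a polynomial by substituting
  for each indeterminate its index.
\<close>
definition eval_at_indices :: "((real \<Rightarrow>\<^sub>0 nat) \<Rightarrow>\<^sub>0 rat) \<Rightarrow> real" where
  "eval_at_indices p =
     (\<Sum>m\<in>Poly_Mapping.keys p. of_rat (Poly_Mapping.lookup p m) * (\<Prod>c\<in>Poly_Mapping.keys m. c ^ Poly_Mapping.lookup m c))"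

definition alg_indep_over_rat :: "real set \<Rightarrow> bool" where
  "alg_indep_over_rat C \<longleftrightarrow>
     (\<forall>p. (\<forall>m\<in>Poly_Mapping.keys p. Poly_Mapping.keys m \<subseteq> C) \<and> eval_at_indices p = 0 \<longrightarrow> p = 0)"

end

theory Submission
  imports Defs
begin

text \<open>
  Let \<open>X' = S \<union> Q\<close> inside the compact space \<open>ext_incr\<close>.  Since the set of points with \<open>n\<close>-th coordinate
  \<open>\<infinity>\<close> is compact and contained in \<open>Q\<close>, every continuous \<open>\<Psi>\<close> on a finite power of \<open>X'\<close> has a function \<open>g\<close>
  such that \<open>\<Psi> x n \<le> g n\<close> whenever all \<open>x\<^sub>i n\<close> exceed \<open>g n\<close>.  Choose a member of the scale that is not
  \<open>\<le>\<^sub>F g\<close>.  Tuples of later members exceed \<open>g\<close> on a positive set, and fewer than \<open>\<bb>(F)\<close> slices of lower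
  dimension contain all other tuples, so induction on the dimension bounds the image of \<open>\<Psi>\<close>.  The
  powers of the generated field are countable unions of continuous images of powers of \<open>X'\<close>.

  Algebraic independence gives \<open>\<rat>(X) \<inter> C = X\<close>, so \<open>X\<close> is closed in \<open>\<rat>(X)\<close>.  If \<open>\<rat>(X)\<close> were \<open>\<sigma>\<close>-compact,
  some uncountable closed subset of the Baire space would lie in \<open>S\<close>, hence \<open>S\<close> would contain a bounded
  Cantor set; but bounded subsets of \<open>S\<close> have cardinality less than \<open>\<bb>(F)\<close>.
\<close>

section \<open>Filters and small sets\<close>

lemma filter_imp_semifilter: "is_filter_nat F \<Longrightarrow> is_semifilter F"
  by (simp add: is_filter_nat_def)

lemma semifilter_almost_mono: "is_semifilter F \<Longrightarrow> A \<in> F \<Longrightarrow> finite (A - B) \<Longrightarrow> B \<in> F"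
  unfolding is_semifilter_def almost_subset_def by blast

lemma semifilter_mono: "is_semifilter F \<Longrightarrow> A \<in> F \<Longrightarrow> A \<subseteq> B \<Longrightarrow> B \<in> F"
  by (metis semifilter_almost_mono Diff_eq_empty_iff finite.emptyI)

lemma semifilter_cofinite:
  assumes "is_semifilter F" and "finite (- A)"
  shows "A \<in> F"
proof -
  obtain B where "B \<in> F"
    using assms(1) unfolding is_semifilter_def by blast
  moreover have "finite (B - A)"
    using assms(2) by (simp add: Diff_eq)
  ultimately show ?thesis
    by (rule semifilter_almost_mono[OF assms(1)])
qed

lemma filter_Int: "is_filter_nat F \<Longrightarrow> A \<in> F \<Longrightarrow> B \<in> F \<Longrightarrow> A \<inter> B \<in> F"
  by (simp add: is_filter_nat_def)

lemma filter_finite_INT: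
  assumes "is_filter_nat F" and "finite N" and "\<And>s. s \<in> N \<Longrightarrow> A s \<in> F"
  shows "(\<Inter>s\<in>N. A s) \<in> F"
  using assms(2,3)
proof (induction N)
  case empty
  then show ?case
    using semifilter_cofinite[OF filter_imp_semifilter[OF assms(1)], of UNIV] by simp
next
  case (insert s N)
  then show ?case
    by (simp add: filter_Int[OF assms(1)])
qed

text \<open>For \<open>A\<close> outside \<open>F\<close>, adjoin \<open>- A\<close> to
  \<open>F\<close>: each \<open>D - A\<close> with \<open>D \<in> F\<close> is infinite, since
  otherwise \<open>A\<close> would almost contain a member of \<open>F\<close>. Maximality then puts
  \<open>- A\<close> into \<open>F\<close>.\<close>

lemma positive_sets_ultrafilter:
  assumes U: "is_ultrafilter_nat F"
  shows "positive_sets F = F"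
proof -
  have F: "is_filter_nat F" and max: "\<And>G. is_filter_nat G \<Longrightarrow> F \<subseteq> G \<Longrightarrow> G = F"
    using U by (auto simp: is_ultrafilter_nat_def)
  have sF: "is_semifilter F" using F by (rule filter_imp_semifilter)
  have inf: "infinite A" if "A \<in> F" for A
    using that sF unfolding is_semifilter_def by blast
  have "- A \<notin> F" if "A \<in> F" for A
    using filter_Int[OF F that, of "- A"] inf[of "{}"] by auto
  moreover have "- A \<in> F" if A: "A \<notin> F" for A
  proof -
    let ?G = "{B. \<exists>D\<in>F. almost_subset (D - A) B}"
    have infD: "infinite (D - A)" if "D \<in> F" for D
      using that A semifilter_almost_mono[OF sF] by blast
    have cof: "UNIV \<in> F" using semifilter_cofinite[OF sF, of UNIV] by simp
    have "is_filter_nat ?G"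
      unfolding is_filter_nat_def is_semifilter_def
    proof (intro conjI ballI allI impI)
      have "UNIV \<in> ?G" using cof by (auto simp: almost_subset_def)
      then show "?G \<noteq> {}" by blast
    next
      fix B assume "B \<in> ?G"
      then obtain D where D: "D \<in> F" "finite (D - A - B)" by (auto simp: almost_subset_def)
      show "infinite B"
      proof
        assume "finite B"
        then have "finite (B \<union> (D - A - B))" using D by simp
        then have "finite (D - A)" by (rule rev_finite_subset) auto
        with infD[OF D(1)] show False by simp
      qed
    next
      fix B B' assume "B \<in> ?G" "almost_subset B B'"
      then obtain D where D: "D \<in> F" "finite (D - A - B)" "finite (B - B')"
        by (auto simp: almost_subset_def)
      have "finite ((D - A - B) \<union> (B - B'))" using D by simp
      then have "finite (D - A - B')" by (rule rev_finite_subset) auto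
      then show "B' \<in> ?G" using D(1) by (intro CollectI bexI[of _ D]) (simp_all add: almost_subset_def)
    next
      fix B B' assume "B \<in> ?G" "B' \<in> ?G"
      then obtain D D' where D: "D \<in> F" "finite (D - A - B)" "D' \<in> F" "finite (D' - A - B')"
        by (auto simp: almost_subset_def)
      have "finite ((D - A - B) \<union> (D' - A - B'))" using D by simp
      then have "finite (D \<inter> D' - A - (B \<inter> B'))" by (rule rev_finite_subset) auto
      then show "B \<inter> B' \<in> ?G"
        using D filter_Int[OF F, of D D'] by (intro CollectI bexI[of _ "D \<inter> D'"]) (simp_all add: almost_subset_def)
    qed
    moreover have "F \<subseteq> ?G"
    proof
      fix B assume "B \<in> F"
      moreover have "almost_subset (B - A) B"
        using finite_subset[of "B - A - B" "{}"] by (auto simp: almost_subset_def)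
      ultimately show "B \<in> ?G" by auto
    qed
    ultimately have "?G = F" by (rule max)
    moreover have "- A \<in> ?G"
      using cof by (intro CollectI bexI[of _ UNIV]) (simp_all add: almost_subset_def Diff_eq)
    ultimately show ?thesis by simp
  qed
  ultimately show ?thesis by (auto simp: positive_sets_def)
qed

section \<open>Boundedness modulo a semifilter and small index sets\<close>

lemma le_mod_mono:
  assumes "is_semifilter F" and "le_mod F f g" and "\<And>n. f' n \<le> f n" and "\<And>n. g n \<le> g' n"
  shows "le_mod F f' g'"
proof -
  have "{n. f n \<le> g n} \<subseteq> {n. f' n \<le> g' n}"
    by clarify (meson assms(3,4) order_trans)
  then show ?thesis
    using semifilter_mono[OF assms(1)] assms(2) by (simp add: le_mod_def)
qed

lemma le_mod_refl: "is_semifilter F \<Longrightarrow> le_mod F f f"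
  by (simp add: le_mod_def semifilter_cofinite)

text \<open>Stands for "fewer than \<open>b(F)\<close> elements". It is phrased by bounds of indexed
  families, so that closure under unions and images comes from pointwise maxima and
  composition.\<close>

definition small_wrt :: "nat set set \<Rightarrow> 'a set \<Rightarrow> bool" where
  "small_wrt F A \<longleftrightarrow> (\<forall>h :: 'a \<Rightarrow> nat \<Rightarrow> nat. bounded_wrt (le_mod F) (h ` A))"

lemma countable_small:
  assumes F: "is_semifilter F" and A: "countable A"
  shows "small_wrt F A"
  unfolding small_wrt_def
proof
  fix h :: "'a \<Rightarrow> nat \<Rightarrow> nat"
  let ?e = "to_nat_on A"
  \<comment> \<open>Diagonalization: only the finitely many functions with code at most
    \<open>n\<close> enter at \<open>n\<close>, so \<open>h a\<close> lies below \<open>g\<close>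
    from \<open>?e a\<close> on.\<close>
  define g where "g = (\<lambda>n. \<Sum>a\<in>{a\<in>A. ?e a \<le> n}. h a n)"
  have fin: "finite {a\<in>A. ?e a \<le> n}" for n
    by (rule inj_on_finite[where f = ?e and B = "{..n}"])
       (auto intro: inj_on_subset[OF inj_on_to_nat_on[OF A]])
  have "le_mod F (h a) g" if a: "a \<in> A" for a
  proof -
    have "h a n \<le> g n" if "?e a \<le> n" for n
      unfolding g_def by (rule member_le_sum) (use that a fin in auto)
    then have "- {n. h a n \<le> g n} \<subseteq> {..?e a}"
      using nat_le_linear by fastforce
    then have "finite (- {n. h a n \<le> g n})" by (rule finite_subset) simp
    then show ?thesis unfolding le_mod_def by (rule semifilter_cofinite[OF F])
  qed
  then show "bounded_wrt (le_mod F) (h ` A)" by (auto simp: bounded_wrt_def)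
qed

lemma small_Un:
  assumes F: "is_semifilter F" and "small_wrt F A" "small_wrt F B"
  shows "small_wrt F (A \<union> B)"
  unfolding small_wrt_def
proof
  fix h :: "'a \<Rightarrow> nat \<Rightarrow> nat"
  obtain g1 where g1: "\<And>a. a \<in> A \<Longrightarrow> le_mod F (h a) g1"
    using assms(2)[unfolded small_wrt_def, rule_format, of h] by (auto simp: bounded_wrt_def)
  obtain g2 where g2: "\<And>a. a \<in> B \<Longrightarrow> le_mod F (h a) g2"
    using assms(3)[unfolded small_wrt_def, rule_format, of h] by (auto simp: bounded_wrt_def)
  have "le_mod F (h a) (\<lambda>n. max (g1 n) (g2 n))" if "a \<in> A \<union> B" for a
    using that le_mod_mono[OF F g1, of a "h a"] le_mod_mono[OF F g2, of a "h a"] by auto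
  then show "bounded_wrt (le_mod F) (h ` (A \<union> B))" by (auto simp: bounded_wrt_def)
qed

lemma small_image:
  assumes "small_wrt F A"
  shows "small_wrt F (f ` A)"
  unfolding small_wrt_def
proof
  fix h :: "'b \<Rightarrow> nat \<Rightarrow> nat"
  have "bounded_wrt (le_mod F) ((h \<circ> f) ` A)" using assms by (simp add: small_wrt_def)
  then show "bounded_wrt (le_mod F) (h ` f ` A)" by (simp add: image_comp)
qed

lemma small_finite_Sigma:
  assumes F: "is_semifilter F" and "finite I" and "small_wrt F A"
  shows "small_wrt F (I \<times> A)"
  using assms(2)
proof (induction I)
  case empty
  then show ?case by (simp add: countable_small[OF F])
next
  case (insert i I)
  have "insert i I \<times> A = (\<lambda>a. (i, a)) ` A \<union> I \<times> A" by auto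
  then show ?case
    using insert.IH small_image[OF assms(3), of "\<lambda>a. (i, a)"] small_Un[OF F] by metis
qed

context
  includes cardinal_syntax
begin

lemma card_less_b_number_small:
  assumes F: "is_semifilter F" and "|A| <o b_number F"
  shows "small_wrt F A"
  unfolding small_wrt_def
proof (rule allI, rule ccontr)
  fix h :: "'a \<Rightarrow> nat \<Rightarrow> nat"
  assume "\<not> bounded_wrt (le_mod F) (h ` A)"
  then have "b_number F \<le>o |h ` A|" using b_number_minimal[OF F] by metis
  then have "b_number F \<le>o |A|" using card_of_image ordLeq_transitive by blast
  with assms(2) show False using not_ordLess_ordLeq by blast
qed

text \<open>Scale members indexed at or after \<open>s\<close> dominate \<open>s\<close> modulo
  \<open>F\<close>. The exceptions have indices in a proper initial segment of a cardinal order,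
  which has smaller cardinality.\<close>

lemma b_scale_below_card:
  assumes F: "is_semifilter F" and S: "is_b_scale F S" and s: "s \<in> S"
  shows "|{t \<in> S. \<not> le_mod F s t}| <o b_number F"
proof -
  obtain Y where Y: "b_number F = |Y|" using b_number_minimal[OF F] by metis
  have co: "Card_order (b_number F)" unfolding Y by (rule card_of_Card_order)
  obtain f where f: "S = f ` Field (b_number F)"
    and le: "\<And>\<alpha> \<beta>. (\<alpha>, \<beta>) \<in> b_number F \<Longrightarrow> \<alpha> \<noteq> \<beta> \<Longrightarrow> le_mod F (f \<alpha>) (f \<beta>)"
    using S unfolding is_b_scale_def by blast
  obtain \<alpha> where \<alpha>: "\<alpha> \<in> Field (b_number F)" "s = f \<alpha>" using s f by auto
  have "t \<in> f ` underS (b_number F) \<alpha>" if t: "t \<in> S" "\<not> le_mod F s t" for t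
  proof -
    obtain \<beta> where \<beta>: "\<beta> \<in> Field (b_number F)" "t = f \<beta>" using t f by auto
    have ne: "\<beta> \<noteq> \<alpha>" using t(2) \<alpha> \<beta> le_mod_refl[OF F] by auto
    have "total_on (Field (b_number F)) (b_number F)"
      using co by (simp add: card_order_on_def well_order_on_def linear_order_on_def)
    then have "(\<beta>, \<alpha>) \<in> b_number F"
      using ne \<alpha> \<beta> t(2) le[of \<alpha> \<beta>] by (auto simp: total_on_def)
    then show ?thesis using ne \<beta> by (auto simp: underS_def)
  qed
  then have "|{t \<in> S. \<not> le_mod F s t}| \<le>o |f ` underS (b_number F) \<alpha>|"
    by (intro card_of_mono1) auto
  also have "|f ` underS (b_number F) \<alpha>| \<le>o |underS (b_number F) \<alpha>|" by (rule card_of_image)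
  also have "|underS (b_number F) \<alpha>| <o b_number F"
    using card_of_underS[OF co \<alpha>(1)] .
  finally show ?thesis .
qed

end

lemma b_scale_below_small:
  assumes F: "is_semifilter F" and S: "is_b_scale F S" and s: "s \<in> S"
  shows "small_wrt F {t \<in> S. \<not> le_mod F s t}"
  by (rule card_less_b_number_small[OF F b_scale_below_card[OF assms]])

section \<open>Finite powers of the scale\<close>

lemma compactin_incseq_cover:
  fixes W :: "nat \<Rightarrow> 'a set"
  assumes "compactin T K" and W: "\<And>B. openin T (W B)" and "incseq W" and "K \<subseteq> (\<Union>B. W B)"
  shows "\<exists>B. K \<subseteq> W B"
proof -
  obtain \<F> where \<F>: "finite \<F>" "\<F> \<subseteq> range W" "K \<subseteq> \<Union>\<F>"
    using compactinD[OF assms(1), of "range W"] W assms(4) by blast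
  obtain N where N: "finite N" "\<F> = W ` N"
    using finite_subset_image[OF \<F>(1,2)] by blast
  have "W n \<subseteq> W (Max (insert 0 N))" if "n \<in> N" for n
    using that N(1) by (intro incseqD[OF assms(3)]) simp
  then show ?thesis using N(2) \<F>(3) by blast
qed

lemma openin_coordinates_le:
  fixes \<Psi> :: "'a \<Rightarrow> nat \<Rightarrow> nat"
  assumes "continuous_map T euclidean \<Psi>"
  shows "openin T {x \<in> topspace T. \<forall>m\<le>n. \<Psi> x m \<le> B}"
proof -
  have "open {f :: nat \<Rightarrow> nat. f m \<le> B}" for m
    using open_vimage[of "{..B}", OF _ continuous_on_product_coordinates[of m]]
    by (simp add: open_discrete vimage_def)
  then have "open (\<Inter>m\<in>{..n}. {f :: nat \<Rightarrow> nat. f m \<le> B})" by blast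
  from openin_continuous_map_preimage[OF assms, of "(\<Inter>m\<in>{..n}. {f. f m \<le> B})"] this
  show ?thesis by (simp add: atMost_def)
qed

text \<open>
  The set of \<open>x \<in> ext_incr\<close> with \<open>x n = \<infinity>\<close> is a compact subset of \<open>X\<close>, and so are its finite
  powers.  Hence \<open>\<Psi>\<close> is bounded up to \<open>n\<close> on some neighbourhood of such a power, and by compactness
  of \<open>ext_incr\<close> the neighbourhood contains all points with large \<open>n\<close>-th coordinates.
\<close>
lemma continuous_bounded_near_infinity:
  fixes \<Psi> :: "('i \<Rightarrow> nat \<Rightarrow> enat) \<Rightarrow> nat \<Rightarrow> nat"
  assumes comp: "compact ext_incr" and inf: "ext_incr_inf \<subseteq> X" and X: "X \<subseteq> ext_incr"
    and I: "finite I"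
    and cont: "continuous_map (product_topology (\<lambda>_. top_of_set X) I) euclidean \<Psi>"
  shows "\<exists>g. \<forall>n. \<forall>x\<in>PiE I (\<lambda>_. X). (\<forall>i\<in>I. enat (g n) < x i n) \<longrightarrow> (\<forall>m\<le>n. \<Psi> x m \<le> g n)"
proof -
  let ?T = "product_topology (\<lambda>_. top_of_set X) I"
  let ?Z = "product_topology (\<lambda>_. top_of_set ext_incr) I"
  \<comment> \<open>Passing to the larger, compact space makes complements of open sets
    compact.\<close>
  have T: "?T = subtopology ?Z (PiE I (\<lambda>_. X))"
    using X by (simp add: subtopology_product_topology subtopology_subtopology inf_absorb2 Int_absorb1)
  have "\<exists>b. \<forall>x\<in>PiE I (\<lambda>_. X). (\<forall>i\<in>I. enat b < x i n) \<longrightarrow> (\<forall>m\<le>n. \<Psi> x m \<le> b)" for n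
  proof -
    define K where "K = {x \<in> ext_incr. x n = \<infinity>}"
    have KX: "K \<subseteq> X" using inf by (auto simp: K_def ext_incr_inf_def)
    have "closed ((\<lambda>x :: nat \<Rightarrow> enat. x n) -` {\<infinity>})"
      by (intro closed_vimage continuous_on_product_coordinates) auto
    moreover have "K = ext_incr \<inter> ((\<lambda>x. x n) -` {\<infinity>})" by (auto simp: K_def)
    ultimately have "compact K" using comp by auto
    then have "compactin (top_of_set X) K"
      using KX by (simp add: compactin_subtopology)
    then have KI: "compactin ?T (PiE I (\<lambda>_. K))" by (simp add: compactin_PiE)
    define W where "W = (\<lambda>B. {x \<in> topspace ?T. \<forall>m\<le>n. \<Psi> x m \<le> B})"
    have W: "openin ?T (W B)" for B unfolding W_def by (rule openin_coordinates_le[OF cont])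
    moreover have "incseq W"
      unfolding W_def incseq_def by (auto intro: order_trans)
    moreover have "PiE I (\<lambda>_. K) \<subseteq> (\<Union>B. W B)"
    proof
      fix x assume x: "x \<in> PiE I (\<lambda>_. K)"
      then have "x \<in> topspace ?T" using KX by (auto simp: PiE_iff)
      moreover have "\<forall>m\<le>n. \<Psi> x m \<le> (\<Sum>m\<le>n. \<Psi> x m)" by (auto intro: member_le_sum)
      ultimately show "x \<in> (\<Union>B. W B)" unfolding W_def by blast
    qed
    ultimately obtain B where B: "PiE I (\<lambda>_. K) \<subseteq> W B"
      using compactin_incseq_cover[OF KI, of W] by blast
    obtain U where U: "openin ?Z U" "W B = U \<inter> PiE I (\<lambda>_. X)"
      using W[of B] unfolding T openin_subtopology by blast
    have "compact_space ?Z"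
      using comp by (simp add: compact_space_product_topology compact_space_subtopology)
    then have co: "compactin ?Z (topspace ?Z - U)"
      using U(1) by (intro closedin_compact_space closedin_diff closedin_topspace)
    \<comment> \<open>A point outside \<open>U\<close> has a coordinate with finite value at
      \<open>n\<close>, because tuples from \<open>K\<close> lie in \<open>U\<close>. Hence the sets
      \<open>V b\<close> cover the compact complement of \<open>U\<close>.\<close>
    define V where "V = (\<lambda>b :: nat. {x \<in> topspace ?Z. \<exists>i\<in>I. x i n < enat b})"
    have "openin ?Z (V b)" for b
    proof -
      have "openin ?Z {x \<in> topspace ?Z. x i n < enat b}" if "i \<in> I" for i
      proof -
        have 1: "continuous_map ?Z (top_of_set ext_incr) (\<lambda>x. x i)"
          using that by (rule continuous_map_product_projection)
        have "open {f :: nat \<Rightarrow> enat. f n < enat b}"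
          using open_vimage[of "{..<enat b}", OF _ continuous_on_product_coordinates[of n]]
          by (simp add: vimage_def)
        then have "openin (top_of_set ext_incr) (ext_incr \<inter> {f. f n < enat b})" by blast
        from openin_continuous_map_preimage[OF 1 this]
        have "openin ?Z {x \<in> topspace ?Z. x i \<in> ext_incr \<inter> {f. f n < enat b}}" .
        moreover have "{x \<in> topspace ?Z. x i \<in> ext_incr \<inter> {f. f n < enat b}} =
            {x \<in> topspace ?Z. x i n < enat b}"
          using that by (auto simp: PiE_iff)
        ultimately show ?thesis by simp
      qed
      then have "openin ?Z (\<Union>i\<in>I. {x \<in> topspace ?Z. x i n < enat b})" by blast
      moreover have "V b = (\<Union>i\<in>I. {x \<in> topspace ?Z. x i n < enat b})" by (auto simp: V_def)
      ultimately show ?thesis by simp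
    qed
    moreover have "incseq V"
      unfolding V_def incseq_def by (fastforce intro: less_le_trans)
    moreover have "topspace ?Z - U \<subseteq> (\<Union>b. V b)"
    proof
      fix x assume x: "x \<in> topspace ?Z - U"
      then have "x \<notin> PiE I (\<lambda>_. K)" using B U(2) by auto
      then obtain i where i: "i \<in> I" "x i n \<noteq> \<infinity>"
        using x by (auto simp: K_def PiE_iff)
      then obtain b where "x i n = enat b" by auto
      then have "x i n < enat (Suc b)" by simp
      then show "x \<in> (\<Union>b. V b)" using i x by (auto simp: V_def)
    qed
    ultimately obtain b where b: "topspace ?Z - U \<subseteq> V b"
      using compactin_incseq_cover[OF co, of V] by blast
    \<comment> \<open>One number serves both as threshold for the coordinates and as bound for the
      values.\<close>
    have "\<forall>m\<le>n. \<Psi> x m \<le> max b B" if x: "x \<in> PiE I (\<lambda>_. X)" "\<forall>i\<in>I. enat (max b B) < x i n" for x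
    proof -
      have "x \<in> topspace ?Z" using x X by (auto simp: PiE_iff)
      moreover have "x \<notin> V b"
      proof
        assume "x \<in> V b"
        then obtain i where i: "i \<in> I" "x i n < enat b" by (auto simp: V_def)
        have "enat b \<le> enat (max b B)" by simp
        with i x(2) show False by (meson less_le_trans less_asym order_less_le_trans)
      qed
      ultimately have "x \<in> W B" using b U(2) x by blast
      then show ?thesis by (auto simp: W_def)
    qed
    then show ?thesis by blast
  qed
  then show ?thesis by metis
qed

text \<open>A monotone majorant. Feebleness only yields a comparison somewhere inside a block, and
  monotonicity is what carries it to the ends of the block.\<close>

definition running_max :: "(nat \<Rightarrow> nat) \<Rightarrow> nat \<Rightarrow> nat" where
  "running_max f n = Max (f ` {..n})"

lemma le_running_max: "m \<le> n \<Longrightarrow> f m \<le> running_max f n"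
  by (simp add: running_max_def)

lemma mono_running_max: "mono (running_max f)"
  unfolding mono_def running_max_def by (auto intro!: Max_mono)

text \<open>
  The two properties of a boundedness relation that make the induction on the dimension work: it
  is compatible with unions of families of bounded sets with few bounds, and tuples which lie
  beyond a suitable member of the scale satisfy it.
\<close>
definition small_additive :: "nat set set \<Rightarrow> ((nat \<Rightarrow> nat) \<Rightarrow> (nat \<Rightarrow> nat) \<Rightarrow> bool) \<Rightarrow> bool" where
  "small_additive F R \<longleftrightarrow>
     (\<forall>H. bounded_wrt (le_mod F) (running_max ` H) \<longrightarrow> (\<exists>g. \<forall>h\<in>H. \<forall>f. R f h \<longrightarrow> R f g))"

definition scale_dominated ::
  "nat set set \<Rightarrow> (nat \<Rightarrow> nat) set \<Rightarrow> ((nat \<Rightarrow> nat) \<Rightarrow> (nat \<Rightarrow> nat) \<Rightarrow> bool) \<Rightarrow> bool" where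
  "scale_dominated F S R \<longleftrightarrow>
     (\<forall>g. \<exists>s\<in>S. \<exists>g'. \<forall>N y. finite N \<and> N \<subseteq> {t \<in> S. le_mod F s t} \<and>
        (\<forall>n. (\<forall>t\<in>N. g n < t n) \<longrightarrow> (\<forall>m\<le>n. y m \<le> g n)) \<longrightarrow> R y g')"

lemma bounded_wrt_subset: "bounded_wrt R Y \<Longrightarrow> Y' \<subseteq> Y \<Longrightarrow> bounded_wrt R Y'"
  by (auto simp: bounded_wrt_def)

text \<open>Choose a bound \<open>h a\<close> for each \<open>a\<close>. Smallness bounds all
  \<open>running_max (h a)\<close> by one function modulo \<open>F\<close>, and
  \<open>small_additive\<close> converts this into one bound for \<open>R\<close>.\<close>

lemma bounded_small_UN:
  assumes R: "small_additive F R" and A: "small_wrt F A"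
    and "\<And>a. a \<in> A \<Longrightarrow> bounded_wrt R (Y a)"
  shows "bounded_wrt R (\<Union>a\<in>A. Y a)"
proof -
  obtain h where h: "\<And>a f. a \<in> A \<Longrightarrow> f \<in> Y a \<Longrightarrow> R f (h a)"
    using assms(3) unfolding bounded_wrt_def by metis
  have "bounded_wrt (le_mod F) ((running_max \<circ> h) ` A)"
    using A unfolding small_wrt_def by blast
  then have "bounded_wrt (le_mod F) (running_max ` h ` A)" by (simp add: image_comp)
  then obtain g where "\<forall>k\<in>h ` A. \<forall>f. R f k \<longrightarrow> R f g"
    using R unfolding small_additive_def by blast
  then show ?thesis unfolding bounded_wrt_def using h by blast
qed

lemma bounded_Un:
  assumes F: "is_semifilter F" and "small_additive F R" and "bounded_wrt R Y" and "bounded_wrt R Y'"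
  shows "bounded_wrt R (Y \<union> Y')"
proof -
  have "bounded_wrt R (\<Union>b\<in>UNIV. if b then Y else Y')"
    by (rule bounded_small_UN[OF assms(2) countable_small[OF F]]) (auto simp: assms(3,4))
  then show ?thesis by (simp add: UNIV_bool Un_commute)
qed

text \<open>Presents a slice of a power as a continuous image of a lower power, for the induction on
  the dimension.\<close>

lemma continuous_map_fun_upd:
  assumes "i \<in> I" and "y \<in> X"
  shows "continuous_map (product_topology (\<lambda>_. top_of_set X) (I - {i}))
           (product_topology (\<lambda>_. top_of_set X) I) (\<lambda>x. x(i := y))"
proof -
  let ?P = "product_topology (\<lambda>_. top_of_set X) (I - {i})"
  have "continuous_map ?P (top_of_set X) (\<lambda>x. (x(i := y)) k)" if "k \<in> I" for k
  proof (cases "k = i")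
    case True
    then show ?thesis using assms(2) by simp
  next
    case False
    then show ?thesis using that continuous_map_product_projection[of k "I - {i}" "\<lambda>_. top_of_set X"] by simp
  qed
  moreover have "(\<lambda>x. x(i := y)) ` topspace ?P \<subseteq> extensional I"
    using assms(1) by (auto simp: PiE_iff extensional_def)
  ultimately show ?thesis by (simp add: continuous_map_componentwise)
qed

lemma b_scale_subset_ext_incr:
  assumes "is_b_scale F S"
  shows "ext_embed ` S \<union> ext_incr_inf \<subseteq> ext_incr"
proof -
  have "ext_embed s \<in> ext_incr" if "s \<in> S" for s
    using assms that strict_monoD[of s] strict_mono_mono[of s]
    by (auto simp: is_b_scale_def ext_incr_def ext_embed_def mono_def)
  then show ?thesis by (auto simp: ext_incr_inf_def)
qed

text \<open>Tuples with no coordinate in the small set \<open>D\<close> come from scale members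
  above \<open>s\<close> modulo \<open>F\<close>, where \<open>scale_dominated\<close> gives one
  bound. Any other tuple lies in the slice of a position \<open>i\<close> and a value
  \<open>y \<in> D\<close>. The induction hypothesis bounds each slice, and
  \<open>I \<times> D\<close> is small.\<close>

lemma powers_of_scale_bounded:
  fixes S :: "(nat \<Rightarrow> nat) set" and \<Psi> :: "('i \<Rightarrow> nat \<Rightarrow> enat) \<Rightarrow> nat \<Rightarrow> nat"
  assumes F: "is_semifilter F" and S: "is_b_scale F S"
    and R: "small_additive F R" "scale_dominated F S R"
    and comp: "compact ext_incr" and Q: "countable ext_incr_inf"
    and X: "X = ext_embed ` S \<union> ext_incr_inf"
    and "finite I" and "continuous_map (product_topology (\<lambda>_. top_of_set X) I) euclidean \<Psi>"
  shows "bounded_wrt R (\<Psi> ` PiE I (\<lambda>_. X))"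
  using assms(8,9)
proof (induction I arbitrary: \<Psi> rule: finite_psubset_induct)
  case (psubset I)
  have XE: "X \<subseteq> ext_incr" unfolding X by (rule b_scale_subset_ext_incr[OF S])
  obtain g where g: "\<And>n x. x \<in> PiE I (\<lambda>_. X) \<Longrightarrow> (\<forall>i\<in>I. enat (g n) < x i n) \<Longrightarrow> \<forall>m\<le>n. \<Psi> x m \<le> g n"
    using continuous_bounded_near_infinity[OF comp _ XE psubset.hyps psubset.prems]
    unfolding X by blast
  obtain s g' where s: "s \<in> S" and g': "\<forall>N y. finite N \<and> N \<subseteq> {t \<in> S. le_mod F s t} \<and>
        (\<forall>n. (\<forall>t\<in>N. g n < t n) \<longrightarrow> (\<forall>m\<le>n. y m \<le> g n)) \<longrightarrow> R y g'"
    using R(2)[unfolded scale_dominated_def, rule_format, of g] by (elim bexE exE)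
  define D where "D = ext_incr_inf \<union> ext_embed ` {t \<in> S. \<not> le_mod F s t}"
  have D: "small_wrt F D"
    unfolding D_def by (intro small_Un[OF F] countable_small[OF F Q] small_image b_scale_below_small[OF F S s])
  have DX: "D \<subseteq> X" by (auto simp: D_def X)
  define A where "A = {x \<in> PiE I (\<lambda>_. X). \<forall>i\<in>I. x i \<notin> D}"
  have "R (\<Psi> x) g'" if x: "x \<in> A" for x
  proof -
    have "x i \<in> ext_embed ` {t \<in> S. le_mod F s t}" if "i \<in> I" for i
    proof -
      have "x i \<in> X" "x i \<notin> D" using x that by (auto simp: A_def PiE_iff)
      then show ?thesis unfolding D_def X by blast
    qed
    then have "\<forall>i\<in>I. \<exists>u. u \<in> {t \<in> S. le_mod F s t} \<and> x i = ext_embed u" by blast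
    then obtain t where t: "\<forall>i\<in>I. t i \<in> {t \<in> S. le_mod F s t} \<and> x i = ext_embed (t i)"
      by (rule bchoice[THEN exE])
    show ?thesis
    proof (rule g'[rule_format, of "t ` I"], intro conjI allI impI)
      show "finite (t ` I)" using psubset.hyps by simp
      show "t ` I \<subseteq> {t \<in> S. le_mod F s t}" using t by blast
      show "\<Psi> x m \<le> g n" if "\<forall>u\<in>t ` I. g n < u n" "m \<le> n" for n m
        using that(1) t x by (intro g[rule_format, OF _ _ that(2)]) (auto simp: A_def ext_embed_def)
    qed
  qed
  then have bA: "bounded_wrt R (\<Psi> ` A)" by (auto simp: bounded_wrt_def)
  let ?Y = "\<lambda>(i, y). (\<lambda>x. \<Psi> (x(i := y))) ` PiE (I - {i}) (\<lambda>_. X)"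
  have "bounded_wrt R (?Y p)" if p: "p \<in> I \<times> D" for p
  proof -
    obtain i y where iy: "p = (i, y)" "i \<in> I" "y \<in> X" using p DX by auto
    have "continuous_map (product_topology (\<lambda>_. top_of_set X) (I - {i})) euclidean (\<lambda>x. \<Psi> (x(i := y)))"
      using continuous_map_compose[OF continuous_map_fun_upd[OF iy(2,3)] psubset.prems] by (simp add: comp_def)
    then have "bounded_wrt R ((\<lambda>x. \<Psi> (x(i := y))) ` PiE (I - {i}) (\<lambda>_. X))"
      using iy(2) by (intro psubset.IH[of "I - {i}" "\<lambda>x. \<Psi> (x(i := y))"]) blast+
    then show ?thesis by (simp add: iy)
  qed
  then have "bounded_wrt R (\<Union>p\<in>I \<times> D. ?Y p)"
    by (rule bounded_small_UN[OF R(1) small_finite_Sigma[OF F psubset.hyps D]])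
  with bA have "bounded_wrt R (\<Psi> ` A \<union> (\<Union>p\<in>I \<times> D. ?Y p))" by (rule bounded_Un[OF F R(1)])
  moreover have "\<Psi> ` PiE I (\<lambda>_. X) \<subseteq> \<Psi> ` A \<union> (\<Union>p\<in>I \<times> D. ?Y p)"
  proof (rule image_subsetI)
    fix x assume x: "x \<in> PiE I (\<lambda>_. X)"
    show "\<Psi> x \<in> \<Psi> ` A \<union> (\<Union>p\<in>I \<times> D. ?Y p)"
    proof (cases "x \<in> A")
      case False
      then obtain i where i: "i \<in> I" "x i \<in> D" using x by (auto simp: A_def)
      \<comment> \<open>Resetting \<open>i\<close> to \<open>undefined\<close> makes
        \<open>z\<close> extensional on \<open>I - {i}\<close>, as the smaller product
        demands.\<close>
      define z where "z = x(i := undefined)"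
      have "z \<in> PiE (I - {i}) (\<lambda>_. X)" "x = z(i := x i)"
        using x by (auto simp: z_def PiE_iff extensional_def)
      then have "\<Psi> x \<in> (\<lambda>u. \<Psi> (u(i := x i))) ` PiE (I - {i}) (\<lambda>_. X)"
        by (metis (mono_tags, lifting) image_eqI)
      then have "\<Psi> x \<in> ?Y (i, x i)" by simp
      then show ?thesis using i by blast
    qed blast
  qed
  ultimately show ?case by (rule bounded_wrt_subset)
qed

section \<open>Positive sets and feeble filters\<close>

text \<open>By monotonicity the value stays infinite once it is infinite, so a finite list
  determines the sequence.\<close>

lemma countable_ext_incr_inf: "countable ext_incr_inf"
proof (rule countable_subset)
  let ?f = "\<lambda>(l :: enat list) n. if n < length l then l ! n else \<infinity>"
  show "ext_incr_inf \<subseteq> range ?f"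
  proof
    fix f assume "f \<in> ext_incr_inf"
    then obtain n where n: "mono f" "f n = \<infinity>" by (auto simp: ext_incr_inf_def ext_incr_def)
    have "f m = ?f (map f [0..<n]) m" for m
      using monoD[OF n(1), of n m] n(2) by (cases "m < n") auto
    then show "f \<in> range ?f" by (intro range_eqI[of _ _ "map f [0..<n]"]) blast
  qed
qed simp

text \<open>If \<open>f\<close> exceeded \<open>g\<close> on a member of \<open>F\<close>,
  intersecting with the set where \<open>running_max h\<close> is at most \<open>g\<close> would
  make \<open>f\<close> exceed \<open>h\<close> on a member of \<open>F\<close>.\<close>

lemma small_additive_positive_sets:
  assumes F: "is_filter_nat F"
  shows "small_additive F (le_mod (positive_sets F))"
  unfolding small_additive_def
proof (intro allI impI)
  fix H assume "bounded_wrt (le_mod F) (running_max ` H)"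
  then obtain g where g: "\<And>h. h \<in> H \<Longrightarrow> le_mod F (running_max h) g" by (auto simp: bounded_wrt_def)
  have sF: "is_semifilter F" using F by (rule filter_imp_semifilter)
  have "le_mod (positive_sets F) f g" if h: "h \<in> H" and f: "le_mod (positive_sets F) f h" for h f
  proof (rule ccontr)
    assume "\<not> le_mod (positive_sets F) f g"
    then have "- {n. f n \<le> g n} \<in> F" by (simp add: le_mod_def positive_sets_def)
    from filter_Int[OF F this g[OF h, unfolded le_mod_def]] have "- {n. f n \<le> h n} \<in> F"
    proof (rule semifilter_mono[OF sF], intro subsetI)
      fix n assume "n \<in> - {n. f n \<le> g n} \<inter> {n. running_max h n \<le> g n}"
      then show "n \<in> - {n. f n \<le> h n}" using le_running_max[of n n h] by auto
    qed
    with f show False by (simp add: le_mod_def positive_sets_def)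
  qed
  then show "\<exists>g. \<forall>h\<in>H. \<forall>f. le_mod (positive_sets F) f h \<longrightarrow> le_mod (positive_sets F) f g" by blast
qed

text \<open>Take \<open>s\<close> not below \<open>g\<close> modulo \<open>F\<close>; then
  \<open>g\<close> itself is the bound. Where \<open>y\<close> exceeds \<open>g\<close>, some
  \<open>t \<in> N\<close> is at most \<open>g\<close>. If this happened on a member of
  \<open>F\<close>, intersecting with the finitely many sets where \<open>s \<le> t\<close> would
  give \<open>s \<le> g\<close> on a member of \<open>F\<close>.\<close>

lemma scale_dominated_positive_sets:
  assumes F: "is_filter_nat F" and S: "is_b_scale F S"
  shows "scale_dominated F S (le_mod (positive_sets F))"
  unfolding scale_dominated_def
proof (rule allI)
  fix g
  have sF: "is_semifilter F" using F by (rule filter_imp_semifilter)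
  obtain s where s: "s \<in> S" "\<not> le_mod F s g"
    using S unfolding is_b_scale_def bounded_wrt_def by blast
  have "le_mod (positive_sets F) y g"
    if N: "finite N" "N \<subseteq> {t \<in> S. le_mod F s t}"
      and y: "\<forall>n. (\<forall>t\<in>N. g n < t n) \<longrightarrow> (\<forall>m\<le>n. y m \<le> g n)" for N y
  proof (rule ccontr)
    assume "\<not> le_mod (positive_sets F) y g"
    then have "- {n. y n \<le> g n} \<in> F" by (simp add: le_mod_def positive_sets_def)
    moreover have "(\<Inter>t\<in>N. {n. s n \<le> t n}) \<in> F"
      using N by (intro filter_finite_INT[OF F]) (auto simp: le_mod_def)
    ultimately have "- {n. y n \<le> g n} \<inter> (\<Inter>t\<in>N. {n. s n \<le> t n}) \<in> F" by (rule filter_Int[OF F])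
    moreover have "- {n. y n \<le> g n} \<inter> (\<Inter>t\<in>N. {n. s n \<le> t n}) \<subseteq> {n. s n \<le> g n}"
    proof
      fix n assume n: "n \<in> - {n. y n \<le> g n} \<inter> (\<Inter>t\<in>N. {n. s n \<le> t n})"
      have "\<not> (\<forall>t\<in>N. g n < t n)"
      proof
        assume "\<forall>t\<in>N. g n < t n"
        then have "y n \<le> g n" using y by blast
        with n show False by simp
      qed
      then obtain t where t: "t \<in> N" "t n \<le> g n" by (auto simp: not_less)
      moreover have "s n \<le> t n" using n t(1) by simp
      ultimately show "n \<in> {n. s n \<le> g n}" by simp
    qed
    ultimately have "{n. s n \<le> g n} \<in> F" by (rule semifilter_mono[OF sF])
    with s(2) show False by (simp add: le_mod_def)
  qed
  then show "\<exists>s\<in>S. \<exists>g'. \<forall>N y. finite N \<and> N \<subseteq> {t \<in> S. le_mod F s t} \<and>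
        (\<forall>n. (\<forall>t\<in>N. g n < t n) \<longrightarrow> (\<forall>m\<le>n. y m \<le> g n)) \<longrightarrow> le_mod (positive_sets F) y g'"
    using s(1) by (intro bexI[of _ s] exI[of _ g]) auto
qed

section \<open>Feeble filters and interval partitions\<close>

lemma strict_mono_interval:
  fixes h :: "nat \<Rightarrow> nat"
  assumes h: "strict_mono h" and m: "h 0 \<le> m"
  obtains k where "h k \<le> m" "m < h (Suc k)"
proof -
  have ex: "m < h (Suc m)" using strict_mono_imp_increasing[OF h, of "Suc m"] by simp
  define k where "k = (LEAST k. m < h (Suc k))"
  have "m < h (Suc k)" unfolding k_def using ex by (rule LeastI)
  moreover have "h k \<le> m"
  proof (cases k)
    case (Suc j)
    then have "\<not> m < h (Suc j)" using not_less_Least[of j "\<lambda>k. m < h (Suc k)"] by (simp add: k_def)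
    then show ?thesis using Suc by simp
  qed (use m in simp)
  ultimately show thesis by (rule that[rotated])
qed

text \<open>The set where \<open>f \<le> g\<close> meets almost every block. Monotonicity moves
  \<open>f\<close> to the left end, the running maximum moves \<open>g\<close> to the right
  end.\<close>

lemma feeble_interval:
  assumes h: "strict_mono h" and F: "\<And>A. A \<in> F \<Longrightarrow> \<forall>\<^sub>F n in sequentially. A \<inter> {h n..<h (Suc n)} \<noteq> {}"
    and fg: "le_mod F f g" and f: "mono f"
  shows "\<forall>\<^sub>F k in sequentially. f (h k) \<le> running_max g (h (Suc k))"
  using F[OF fg[unfolded le_mod_def]]
proof eventually_elim
  case (elim k)
  then obtain p where p: "f p \<le> g p" "h k \<le> p" "p < h (Suc k)" by auto
  have "f (h k) \<le> f p" using f p(2) by (rule monoD)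
  also have "\<dots> \<le> g p" by (rule p)
  also have "\<dots> \<le> running_max g (h (Suc k))" using p(3) by (intro le_running_max) simp
  finally show ?case .
qed

lemma small_additive_feeble:
  assumes "feeble F"
  shows "small_additive F le_star"
  unfolding small_additive_def
proof (intro allI impI)
  fix H assume "bounded_wrt (le_mod F) (running_max ` H)"
  then obtain g where g: "\<And>u. u \<in> H \<Longrightarrow> le_mod F (running_max u) g" by (auto simp: bounded_wrt_def)
  obtain h where h: "strict_mono h"
    and F: "\<And>A. A \<in> F \<Longrightarrow> \<forall>\<^sub>F n in sequentially. A \<inter> {h n..<h (Suc n)} \<noteq> {}"
    using assms unfolding feeble_def by blast
  \<comment> \<open>For \<open>m\<close> in block \<open>k\<close>, moving \<open>u\<close> to the
    end of the block costs one index and the comparison with \<open>g\<close> another;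
    \<open>k \<le> m\<close> gives \<open>h (k + 2) \<le> h (m + 2)\<close>.\<close>
  define g' where "g' = (\<lambda>m. running_max g (h (m + 2)))"
  have "le_star f g'" if u: "u \<in> H" and f: "le_star f u" for u f
  proof -
    have "\<forall>\<^sub>F k in sequentially. running_max u (h k) \<le> running_max g (h (Suc k))"
      by (rule feeble_interval[OF h F g[OF u] mono_running_max])
    then obtain k0 where k0: "\<And>k. k \<ge> k0 \<Longrightarrow> running_max u (h k) \<le> running_max g (h (Suc k))"
      by (auto simp: eventually_sequentially)
    have "u m \<le> g' m" if m: "m \<ge> h k0" for m
    proof -
      have "h 0 \<le> m" using m strict_monoD[OF h, of 0 k0] by (cases k0) auto
      then obtain k where k: "h k \<le> m" "m < h (Suc k)" by (rule strict_mono_interval[OF h])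
      have "h k0 < h (Suc k)" using k m by simp
      then have kk: "k0 \<le> k" using strict_mono_less[OF h] by auto
      have km: "k \<le> m" using strict_mono_imp_increasing[OF h, of k] k(1) by simp
      have "u m \<le> running_max u (h (Suc k))" using k(2) by (intro le_running_max) simp
      also have "\<dots> \<le> running_max g (h (Suc (Suc k)))" using kk by (intro k0) simp
      also have "\<dots> \<le> g' m" unfolding g'_def
        using km strict_mono_less_eq[OF h] by (intro monoD[OF mono_running_max]) simp
      finally show ?thesis .
    qed
    then have "\<forall>\<^sub>F m in sequentially. u m \<le> g' m" by (auto simp: eventually_sequentially)
    with f show ?thesis unfolding le_star_def by eventually_elim simp
  qed
  then show "\<exists>g. \<forall>h\<in>H. \<forall>f. le_star f h \<longrightarrow> le_star f g" by blast
qed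

text \<open>
  If \<open>s\<close> exceeds a suitable function at some \<open>m\<close> between \<open>h k\<close> and \<open>h (k + 1)\<close>, then every \<open>t\<close>
  with \<open>s \<le>\<^sub>F t\<close> is large at \<open>h (k + 2)\<close> when \<open>k\<close> is large.  This bounds \<open>y\<close> up to \<open>h (k + 2)\<close>
  for infinitely many \<open>k\<close> that do not depend on \<open>y\<close>, hence almost everywhere.
\<close>
lemma scale_dominated_feeble:
  assumes F: "is_filter_nat F" and S: "is_b_scale F S" and "feeble F"
  shows "scale_dominated F S le_star"
  unfolding scale_dominated_def
proof (rule allI)
  fix g
  have sF: "is_semifilter F" using F by (rule filter_imp_semifilter)
  obtain h where h: "strict_mono h"
    and hF: "\<And>A. A \<in> F \<Longrightarrow> \<forall>\<^sub>F n in sequentially. A \<inter> {h n..<h (Suc n)} \<noteq> {}"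
    using assms unfolding feeble_def by blast
  \<comment> \<open>The shift makes \<open>g1 p\<close> at least \<open>g (h (k + 2))\<close> for
    every \<open>p\<close> in block \<open>k\<close>, because \<open>k \<le> p\<close>.\<close>
  define g1 where "g1 = (\<lambda>m. running_max g (h (m + 2)))"
  obtain s where s: "s \<in> S" "\<not> le_mod F s g1"
    using S unfolding is_b_scale_def bounded_wrt_def by blast
  have mon: "strict_mono t" if "t \<in> S" for t using that S by (auto simp: is_b_scale_def)
  \<comment> \<open>Right ends of the blocks that follow a block where \<open>s\<close> exceeds
    \<open>g1\<close> somewhere. They are unbounded since \<open>s\<close> is not below
    \<open>g1\<close> modulo \<open>F\<close>.\<close>
  define L where "L = {h (k + 2) | k. \<exists>m. g1 m < s m \<and> h k \<le> m \<and> m < h (Suc k)}"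
  have L: "\<exists>n\<in>L. b \<le> n" for b
  proof -
    have "infinite (- {m. s m \<le> g1 m})"
      using s(2) semifilter_cofinite[OF sF] by (auto simp: le_mod_def)
    then obtain m where m: "m \<ge> b + h 0" "g1 m < s m"
      unfolding infinite_nat_iff_unbounded_le by (auto simp: not_le)
    have "h 0 \<le> m" using m(1) by simp
    then obtain k where k: "h k \<le> m" "m < h (Suc k)" by (rule strict_mono_interval[OF h])
    have "h (Suc k) < h (k + 2)" using h by (simp add: strict_monoD)
    then have "b \<le> h (k + 2)" using k m by simp
    then show ?thesis unfolding L_def using k m(2) by blast
  qed
  \<comment> \<open>Rounding \<open>m\<close> up to the next \<open>n \<in> L\<close> is harmless:
    control at \<open>n\<close> covers all arguments up to \<open>n\<close>.\<close>
  define g' where "g' = (\<lambda>m. g (LEAST n. n \<in> L \<and> m \<le> n))"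
  have "le_star y g'"
    if N: "finite N" "N \<subseteq> {t \<in> S. le_mod F s t}"
      and y: "\<forall>n. (\<forall>t\<in>N. g n < t n) \<longrightarrow> (\<forall>m\<le>n. y m \<le> g n)" for N y
  proof -
    have "\<forall>\<^sub>F k in sequentially. s (h k) \<le> t (h (Suc k))" if "t \<in> N" for t
    proof -
      have t: "t \<in> S" "le_mod F s t" using that N by auto
      have "running_max t n = t n" for n
        unfolding running_max_def
        using strict_mono_mono[OF mon[OF t(1)]] by (intro Max_eqI) (auto simp: mono_def)
      then show ?thesis
        using feeble_interval[OF h hF t(2) strict_mono_mono[OF mon[OF s(1)]]] by simp
    qed
    then have "\<forall>\<^sub>F k in sequentially. \<forall>t\<in>N. s (h k) \<le> t (h (Suc k))"
      using N(1) by (simp add: eventually_ball_finite_distrib)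
    then obtain k0 where k0: "\<And>k t. k \<ge> k0 \<Longrightarrow> t \<in> N \<Longrightarrow> s (h k) \<le> t (h (Suc k))"
      by (auto simp: eventually_sequentially)
    have "y m \<le> g' m" if m: "m \<ge> h (k0 + 2)" for m
    proof -
      define n where "n = (LEAST n. n \<in> L \<and> m \<le> n)"
      have n: "n \<in> L" "m \<le> n" using LeastI_ex[of "\<lambda>n. n \<in> L \<and> m \<le> n"] L[of m] by (auto simp: n_def)
      then obtain k p where k: "n = h (k + 2)" "g1 p < s p" "h k \<le> p" "p < h (Suc k)" by (auto simp: L_def)
      have "h (k0 + 2) \<le> h (k + 2)" using m n k by simp
      then have "k0 \<le> k" using strict_mono_less_eq[OF h] by simp
      have "g n < t n" if t: "t \<in> N" for t
      proof -
        have "k \<le> p" using strict_mono_imp_increasing[OF h, of k] k(3) by simp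
        then have "h (k + 2) \<le> h (p + 2)" using strict_mono_less_eq[OF h] by simp
        then have "g n \<le> g1 p" unfolding k(1) g1_def by (rule le_running_max)
        also have "\<dots> < s p" by (rule k)
        also have "\<dots> \<le> s (h (Suc k))"
          using k(4) strict_mono_less_eq[OF mon[OF s(1)]] by simp
        also have "\<dots> \<le> t n" using k0[of "Suc k" t] t \<open>k0 \<le> k\<close> by (simp add: k(1))
        finally show ?thesis .
      qed
      then have "y m \<le> g n" using y n(2) by blast
      then show ?thesis by (simp add: g'_def n_def)
    qed
    then show ?thesis by (auto simp: le_star_def eventually_sequentially)
  qed
  then show "\<exists>s\<in>S. \<exists>g'. \<forall>N y. finite N \<and> N \<subseteq> {t \<in> S. le_mod F s t} \<and>
        (\<forall>n. (\<forall>t\<in>N. g n < t n) \<longrightarrow> (\<forall>m\<le>n. y m \<le> g n)) \<longrightarrow> le_star y g'"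
    using s(1) by (intro bexI[of _ s] exI[of _ g']) auto
qed

section \<open>Algebraic independence\<close>

lemma is_subfield_gen_field: "is_subfield (gen_field X)"
  unfolding gen_field_def
proof (rule hull_in)
  show "is_subfield (\<Inter>\<F>)" if "\<forall>K\<in>\<F>. is_subfield K" for \<F>
    using that unfolding is_subfield_def by blast
qed

lemma gen_field_superset: "\<rat> \<union> X \<subseteq> gen_field X"
  unfolding gen_field_def by (rule hull_subset)

lemma gen_field_minimal: "\<rat> \<union> X \<subseteq> K \<Longrightarrow> is_subfield K \<Longrightarrow> gen_field X \<subseteq> K"
  unfolding gen_field_def by (rule hull_minimal)

section \<open>Monomial values and linear independence over the rationals\<close>

definition monomial_value :: "(real \<Rightarrow>\<^sub>0 nat) \<Rightarrow> real" where
  "monomial_value m = (\<Prod>c\<in>Poly_Mapping.keys m. c ^ Poly_Mapping.lookup m c)"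

lemma monomial_value_superset:
  assumes "finite A" and "Poly_Mapping.keys m \<subseteq> A"
  shows "monomial_value m = (\<Prod>c\<in>A. c ^ Poly_Mapping.lookup m c)"
  unfolding monomial_value_def
  by (rule prod.mono_neutral_left) (use assms in \<open>auto simp: in_keys_iff\<close>)

lemma monomial_value_add: "monomial_value (m + n) = monomial_value m * monomial_value n"
proof -
  let ?A = "Poly_Mapping.keys m \<union> Poly_Mapping.keys n"
  have "monomial_value (m + n) = (\<Prod>c\<in>?A. c ^ Poly_Mapping.lookup (m + n) c)"
    by (rule monomial_value_superset) (simp_all add: Poly_Mapping.keys_add)
  also have "\<dots> = (\<Prod>c\<in>?A. c ^ Poly_Mapping.lookup m c) * (\<Prod>c\<in>?A. c ^ Poly_Mapping.lookup n c)"
    by (simp add: lookup_add power_add prod.distrib)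
  also have "\<dots> = monomial_value m * monomial_value n"
    by (simp add: monomial_value_superset[of ?A])
  finally show ?thesis .
qed

lemma monomial_value_single: "monomial_value (Poly_Mapping.single c 1) = c"
  by (simp add: monomial_value_def)

definition monomials :: "real set \<Rightarrow> (real \<Rightarrow>\<^sub>0 nat) set" where
  "monomials A = {m. Poly_Mapping.keys m \<subseteq> A}"

lemma monomials_add: "m \<in> monomials A \<Longrightarrow> n \<in> monomials A \<Longrightarrow> m + n \<in> monomials A"
  using Poly_Mapping.keys_add[of m n] by (auto simp: monomials_def)

text \<open>The coefficients on \<open>T\<close>, extended by 0, form a polynomial with support in
  \<open>T\<close> whose value is the given sum.\<close>

lemma alg_indep_coefficients_zero:
  fixes a :: "(real \<Rightarrow>\<^sub>0 nat) \<Rightarrow> rat"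
  assumes C: "alg_indep_over_rat C" and T: "finite T" "T \<subseteq> monomials C"
    and sum: "(\<Sum>m\<in>T. of_rat (a m) * monomial_value m) = (0 :: real)" and m: "m \<in> T"
  shows "a m = 0"
proof -
  define p where "p = Poly_Mapping.Abs_poly_mapping (\<lambda>m. if m \<in> T then a m else 0)"
  have "finite {m. (if m \<in> T then a m else 0) \<noteq> 0}"
    by (rule finite_subset[OF _ T(1)]) auto
  then have lookup: "Poly_Mapping.lookup p = (\<lambda>m. if m \<in> T then a m else 0)"
    unfolding p_def by (simp add: Poly_Mapping.lookup_Abs_poly_mapping)
  then have keys: "Poly_Mapping.keys p \<subseteq> T" by (auto simp: in_keys_iff split: if_splits)
  have "eval_at_indices p = (\<Sum>m\<in>T. of_rat (a m) * monomial_value m)"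
    unfolding eval_at_indices_def monomial_value_def
    by (rule sum.mono_neutral_cong_left) (use T(1) keys in \<open>auto simp: in_keys_iff lookup\<close>)
  then have "eval_at_indices p = 0" using sum by simp
  moreover have "\<forall>m\<in>Poly_Mapping.keys p. Poly_Mapping.keys m \<subseteq> C"
    using keys T(2) by (auto simp: monomials_def)
  ultimately have "p = 0" using C by (simp add: alg_indep_over_rat_def)
  then show ?thesis using lookup m by (metis lookup_zero)
qed

text \<open>With the reals as a rational vector space, algebraic independence becomes linear
  independence of monomial values.\<close>

interpretation rat_real: vector_space "\<lambda>(q :: rat) (x :: real). of_rat q * x"
  by unfold_locales (simp_all add: algebra_simps of_rat_add of_rat_mult)

lemma inj_on_monomial_value:
  assumes "alg_indep_over_rat C"
  shows "inj_on monomial_value (monomials C)"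
proof (rule inj_onI, rule ccontr)
  fix m n assume mn: "m \<in> monomials C" "n \<in> monomials C" "monomial_value m = monomial_value n" "m \<noteq> n"
  then have "(\<Sum>k\<in>{m, n}. of_rat (if k = m then 1 else - 1) * monomial_value k) = 0" by (simp add: of_rat_minus)
  from alg_indep_coefficients_zero[OF assms _ _ this, of m] mn show False by simp
qed

lemma independent_monomial_values:
  assumes "alg_indep_over_rat C"
  shows "rat_real.independent (monomial_value ` monomials C)"
  unfolding rat_real.dependent_explicit
proof (clarify)
  fix t v and u :: "real \<Rightarrow> rat"
  assume t: "finite t" "t \<subseteq> monomial_value ` monomials C"
    and sum: "(\<Sum>v\<in>t. of_rat (u v) * v) = 0" and v: "v \<in> t" "u v \<noteq> 0"
  obtain T where T: "T \<subseteq> monomials C" "finite T" "t = monomial_value ` T"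
    using finite_subset_image[OF t] by blast
  have "inj_on monomial_value T" using inj_on_monomial_value[OF assms] T(1) by (rule inj_on_subset)
  then have "(\<Sum>m\<in>T. of_rat (u (monomial_value m)) * monomial_value m) = 0"
    using sum unfolding T(3) by (simp add: sum.reindex)
  from alg_indep_coefficients_zero[OF assms T(2,1) this] v T(3) show False by auto
qed

text \<open>The unique representation of \<open>x\<close> over \<open>B\<close> is supported in both
  \<open>B1\<close> and \<open>B2\<close>, hence nowhere.\<close>

lemma span_disjoint_zero:
  assumes B: "rat_real.independent B" and sub: "B1 \<subseteq> B" "B2 \<subseteq> B" and disj: "B1 \<inter> B2 = {}"
    and x: "x \<in> rat_real.span B1" "x \<in> rat_real.span B2"
  shows "x = 0"
proof -
  let ?r = "rat_real.representation B x"
  have "?r = rat_real.representation B1 x" "?r = rat_real.representation B2 x"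
    using B x sub by (auto intro: rat_real.representation_extend)
  then have "?r b = 0" for b
    using rat_real.representation_ne_zero[of B1 x b] rat_real.representation_ne_zero[of B2 x b] disj by auto
  moreover have "x \<in> rat_real.span B" using x(1) rat_real.span_mono[OF sub(1)] by blast
  ultimately show ?thesis using rat_real.sum_nonzero_representation_eq[OF B, of x] by simp
qed

text \<open>The ring generated by \<open>A\<close> over the rationals, presented as a span to make
  linear independence applicable.\<close>

definition poly_values :: "real set \<Rightarrow> real set" where
  "poly_values A = rat_real.span (monomial_value ` monomials A)"

lemma
  shows poly_values_0: "0 \<in> poly_values A"
    and poly_values_add: "x \<in> poly_values A \<Longrightarrow> y \<in> poly_values A \<Longrightarrow> x + y \<in> poly_values A"
    and poly_values_minus: "x \<in> poly_values A \<Longrightarrow> - x \<in> poly_values A"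
  unfolding poly_values_def by (fact rat_real.span_zero rat_real.span_add rat_real.span_neg)+

text \<open>The product is linear in each factor: span induction on \<open>x\<close> against a fixed
  generator, then on \<open>y\<close>.\<close>

lemma span_mult:
  assumes x: "x \<in> rat_real.span B1" and y: "y \<in> rat_real.span B2"
    and B: "\<And>u v. u \<in> B1 \<Longrightarrow> v \<in> B2 \<Longrightarrow> u * v \<in> rat_real.span B"
  shows "x * y \<in> rat_real.span B"
proof -
  have sub: "rat_real.subspace {u. u * v \<in> rat_real.span B}" for v
    unfolding rat_real.subspace_def
    by (auto simp: distrib_right mult.assoc rat_real.span_zero intro: rat_real.span_add rat_real.span_scale)
  have "x * v \<in> rat_real.span B" if "v \<in> B2" for v
    using x sub by (rule rat_real.span_induct) (rule B[OF _ that])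
  then have "y * x \<in> rat_real.span B"
    by (intro rat_real.span_induct[OF y sub]) (simp add: mult.commute)
  then show ?thesis by (simp add: mult.commute)
qed

lemma poly_values_mult: "x \<in> poly_values A \<Longrightarrow> y \<in> poly_values A \<Longrightarrow> x * y \<in> poly_values A"
  unfolding poly_values_def
proof (erule (1) span_mult)
  fix u v assume "u \<in> monomial_value ` monomials A" "v \<in> monomial_value ` monomials A"
  then have "u * v \<in> monomial_value ` monomials A"
    using monomials_add by (fastforce simp: monomial_value_add[symmetric])
  then show "u * v \<in> rat_real.span (monomial_value ` monomials A)" by (rule rat_real.span_base)
qed

lemma poly_values_superset: "\<rat> \<union> A \<subseteq> poly_values A"
proof
  fix x assume "x \<in> \<rat> \<union> A"
  then consider q where "x = of_rat q" | "x \<in> A" by (auto simp: Rats_def)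
  then show "x \<in> poly_values A"
  proof cases
    case 1
    have "monomial_value 0 = 1" by (simp add: monomial_value_def)
    moreover have "0 \<in> monomials A" by (simp add: monomials_def)
    ultimately have "1 \<in> monomial_value ` monomials A" by (metis image_eqI)
    then have "of_rat q * 1 \<in> poly_values A"
      unfolding poly_values_def by (intro rat_real.span_scale rat_real.span_base)
    then show ?thesis using 1 by simp
  next
    case 2
    then have "Poly_Mapping.single x 1 \<in> monomials A" by (simp add: monomials_def)
    then have "x \<in> monomial_value ` monomials A" by (metis image_eqI monomial_value_single)
    then show ?thesis unfolding poly_values_def by (rule rat_real.span_base)
  qed
qed

lemma gen_field_fraction:
  assumes "x \<in> gen_field A"
  obtains p q where "p \<in> poly_values A" "q \<in> poly_values A" "q \<noteq> 0" "x = p / q"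
proof -
  define K where "K = {p / q | p q. p \<in> poly_values A \<and> q \<in> poly_values A \<and> q \<noteq> 0}"
  have KI: "p / q \<in> K" if "p \<in> poly_values A" "q \<in> poly_values A" "q \<noteq> 0" for p q
    using that by (auto simp: K_def)
  have one: "1 \<in> poly_values A" using poly_values_superset[of A] Rats_1 by blast
  have P: "x \<in> K" if "x \<in> poly_values A" for x using KI[OF that one] by simp
  have "x + y \<in> K \<and> x * y \<in> K" if "x \<in> K" "y \<in> K" for x y
  proof -
    from that obtain p q p' q' where *: "p \<in> poly_values A" "q \<in> poly_values A" "q \<noteq> 0" "x = p / q"
      "p' \<in> poly_values A" "q' \<in> poly_values A" "q' \<noteq> 0" "y = p' / q'" by (auto simp: K_def)
    then have "x + y = (p * q' + p' * q) / (q * q')" "x * y = (p * p') / (q * q')"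
      by (simp_all add: add_frac_eq)
    then show ?thesis using * by (auto intro!: KI poly_values_add poly_values_mult)
  qed
  moreover have "- x \<in> K \<and> inverse x \<in> K" if "x \<in> K" for x
  proof -
    from that obtain p q where *: "p \<in> poly_values A" "q \<in> poly_values A" "q \<noteq> 0" "x = p / q"
      by (auto simp: K_def)
    have "- x = (- p) / q" using * by simp
    then have "- x \<in> K" using KI[OF poly_values_minus[OF *(1)] *(2,3)] by simp
    \<comment> \<open>\<open>inverse 0 = 0\<close> in HOL, so a zero numerator is treated
      apart.\<close>
    moreover have "inverse x \<in> K"
      using * P[OF poly_values_0] by (cases "p = 0") (auto intro!: KI)
    ultimately show ?thesis by blast
  qed
  ultimately have "is_subfield K" using P[OF poly_values_0] P[OF one] by (simp add: is_subfield_def)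
  moreover have "\<rat> \<union> A \<subseteq> K" using poly_values_superset P by blast
  ultimately have "gen_field A \<subseteq> K" by (intro gen_field_minimal)
  then show thesis using assms that by (auto simp: K_def)
qed

text \<open>If \<open>c\<close> in \<open>C\<close> but not in \<open>A\<close> were
  \<open>p / q\<close>, then \<open>c * q = p\<close> would equate a combination of monomials
  containing \<open>c\<close> with one of monomials avoiding it. Independence makes both sides 0, so
  \<open>c = 0\<close>, which independence also excludes.\<close>

lemma gen_field_Int_alg_indep:
  assumes C: "alg_indep_over_rat C" and A: "A \<subseteq> C"
  shows "gen_field A \<inter> C = A"
proof (intro equalityI subsetI)
  fix x assume "x \<in> A"
  then show "x \<in> gen_field A \<inter> C" using A gen_field_superset[of A] by blast
next
  fix c assume c: "c \<in> gen_field A \<inter> C"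
  show "c \<in> A"
  proof (rule ccontr)
    assume cA: "c \<notin> A"
    obtain p q where pq: "p \<in> poly_values A" "q \<in> poly_values A" "q \<noteq> 0" "c = p / q"
      using c by (auto elim: gen_field_fraction)
    let ?M = "{m \<in> monomials C. c \<in> Poly_Mapping.keys m}"
    let ?B = "monomial_value ` ?M"
    have "c * q \<in> rat_real.span ?B"
    proof (rule span_mult)
      show "c \<in> rat_real.span {c}" by (rule rat_real.span_base) simp
      show "q \<in> rat_real.span (monomial_value ` monomials A)" using pq(2) by (simp add: poly_values_def)
      fix u v assume "u \<in> {c}" "v \<in> monomial_value ` monomials A"
      then obtain m where m: "u = c" "m \<in> monomials A" "v = monomial_value m" by auto
      have sum: "u * v = monomial_value (Poly_Mapping.single c 1 + m)"
        by (simp add: m monomial_value_add monomial_value_single[simplified])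
      have "Poly_Mapping.single c 1 \<in> monomials C" "m \<in> monomials C"
        using c m A by (auto simp: monomials_def)
      then have "Poly_Mapping.single c 1 + m \<in> ?M"
        using monomials_add by (auto simp: in_keys_iff lookup_add)
      then show "u * v \<in> rat_real.span ?B" unfolding sum by (intro rat_real.span_base imageI)
    qed
    moreover have "c * q = p" using pq by simp
    ultimately have "p \<in> rat_real.span ?B" by simp
    moreover have "?B \<inter> monomial_value ` monomials A = {}"
    proof -
      have inj: "inj_on monomial_value (?M \<union> monomials A)"
        by (rule inj_on_subset[OF inj_on_monomial_value[OF C]]) (use A in \<open>auto simp: monomials_def\<close>)
      have "?M \<inter> monomials A = {}" using cA by (auto simp: monomials_def)
      then show ?thesis using inj_on_image_Int[OF inj Un_upper1 Un_upper2] by simp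
    qed
    ultimately have "p = 0"
      using pq(1) A unfolding poly_values_def
      by (intro span_disjoint_zero[OF independent_monomial_values[OF C], of ?B "monomial_value ` monomials A"])
        (auto simp: monomials_def)
    then have "c = 0" using pq by simp
    moreover have "c \<noteq> 0"
    proof
      assume "c = 0"
      then have "(\<Sum>m\<in>{Poly_Mapping.single c 1}. of_rat 1 * monomial_value m) = 0"
        by (simp add: monomial_value_single[simplified])
      from alg_indep_coefficients_zero[OF C _ _ this] c show False by (simp add: monomials_def)
    qed
    ultimately show False by simp
  qed
qed

section \<open>Finite powers of the generated field\<close>

text \<open>
  The parameter of \<open>Inv\<close> truncates the inverse: \<open>y / max (y\<^sup>2) (1 / (m + 1))\<close> is defined and continuous
  for all real \<open>y\<close>, lies in every field containing \<open>y\<close>, and is the inverse of \<open>y\<close> if \<open>y = 0\<close> or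
  \<open>y\<^sup>2 \<ge> 1 / (m + 1)\<close>.  So terms have no poles, and countably many of them generate the field.
\<close>
datatype field_term =
    Var nat
  | Const rat
  | Add field_term field_term
  | Mul field_term field_term
  | Neg field_term
  | Inv nat field_term

instance field_term :: countable
  by countable_datatype

primrec eval_term :: "field_term \<Rightarrow> (nat \<Rightarrow> real) \<Rightarrow> real" where
  "eval_term (Var i) x = x i"
| "eval_term (Const q) x = of_rat q"
| "eval_term (Add s t) x = eval_term s x + eval_term t x"
| "eval_term (Mul s t) x = eval_term s x * eval_term t x"
| "eval_term (Neg t) x = - eval_term t x"
| "eval_term (Inv m t) x = eval_term t x / max ((eval_term t x)\<^sup>2) (1 / real (Suc m))"

primrec term_vars :: "field_term \<Rightarrow> nat set" where
  "term_vars (Var i) = {i}"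
| "term_vars (Const q) = {}"
| "term_vars (Add s t) = term_vars s \<union> term_vars t"
| "term_vars (Mul s t) = term_vars s \<union> term_vars t"
| "term_vars (Neg t) = term_vars t"
| "term_vars (Inv m t) = term_vars t"

primrec rename_vars :: "(nat \<Rightarrow> nat) \<Rightarrow> field_term \<Rightarrow> field_term" where
  "rename_vars r (Var i) = Var (r i)"
| "rename_vars r (Const q) = Const q"
| "rename_vars r (Add s t) = Add (rename_vars r s) (rename_vars r t)"
| "rename_vars r (Mul s t) = Mul (rename_vars r s) (rename_vars r t)"
| "rename_vars r (Neg t) = Neg (rename_vars r t)"
| "rename_vars r (Inv m t) = Inv m (rename_vars r t)"

lemma eval_rename_vars: "eval_term (rename_vars r t) x = eval_term t (\<lambda>i. x (r i))"
  by (induction t) simp_all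

lemma finite_term_vars: "finite (term_vars t)"
  by (induction t) simp_all

lemma eval_term_cong: "(\<And>i. i \<in> term_vars t \<Longrightarrow> x i = y i) \<Longrightarrow> eval_term t x = eval_term t y"
  by (induction t) simp_all

lemma continuous_map_eval_term:
  assumes "\<And>i. i \<in> term_vars t \<Longrightarrow> continuous_map T euclideanreal (\<lambda>x. f x i)"
  shows "continuous_map T euclideanreal (\<lambda>x. eval_term t (f x))"
  using assms
proof (induction t)
  case (Inv m t)
  then have t: "continuous_map T euclideanreal (\<lambda>x. eval_term t (f x))" by simp
  have pos: "0 < max y (1 / real (Suc m))" for y :: real
    by (rule less_le_trans[OF _ max.cobounded2]) simp
  have ne: "max y (1 / real (Suc m)) \<noteq> 0" for y :: real using pos[of y] by linarith
  have "continuous_map T euclideanreal (\<lambda>x. max ((eval_term t (f x))\<^sup>2) (1 / real (Suc m)))"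
    by (intro continuous_map_real_max continuous_map_real_pow t) simp
  then have "continuous_map T euclideanreal
      (\<lambda>x. eval_term t (f x) / max ((eval_term t (f x))\<^sup>2) (1 / real (Suc m)))"
    by (intro continuous_map_real_divide t ne)
  then show ?case by simp
qed (auto intro!: continuous_intros)

lemma subfield_eval_term:
  assumes K: "is_subfield K" and "\<rat> \<subseteq> K" and "\<And>i. i \<in> term_vars t \<Longrightarrow> x i \<in> K"
  shows "eval_term t x \<in> K"
  using assms(3)
proof (induction t)
  case (Const q)
  then show ?case using assms(2) by (auto simp: Rats_def)
next
  case (Inv m t)
  define y where "y = eval_term t x"
  have y: "y \<in> K" using Inv by (simp add: y_def)
  have mult: "a * b \<in> K" if "a \<in> K" "b \<in> K" for a b using that K by (simp add: is_subfield_def)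
  have "max (y\<^sup>2) (1 / real (Suc m)) \<in> K"
  proof (cases "y\<^sup>2 \<le> 1 / real (Suc m)")
    case True
    have "1 / real (Suc m) \<in> \<rat>" by (intro Rats_divide Rats_1 Rats_of_nat)
    then show ?thesis using True assms(2) by (auto simp: max_def)
  next
    case False
    then show ?thesis using mult[OF y y] by (simp add: max_def power2_eq_square)
  qed
  then have "inverse (max (y\<^sup>2) (1 / real (Suc m))) \<in> K" using K by (simp add: is_subfield_def)
  with y have "y / max (y\<^sup>2) (1 / real (Suc m)) \<in> K" unfolding divide_inverse by (rule mult)
  then show ?case by (simp add: y_def)
qed (use K in \<open>simp_all add: is_subfield_def\<close>)

text \<open>Renaming variable \<open>j\<close> of the \<open>i\<close>-th term to the code of
  \<open>(i, j)\<close> keeps different terms apart, so all assignments merge into one.\<close>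

lemma common_assignment:
  assumes "\<And>i :: nat. \<exists>t x. range x \<subseteq> X \<and> y i = eval_term t x"
  shows "\<exists>s z. range z \<subseteq> X \<and> (\<forall>i. y i = eval_term (s i) z)"
proof -
  obtain t x where tx: "\<And>i. range (x i) \<subseteq> X" "\<And>i. y i = eval_term (t i) (x i)"
    using assms by metis
  define z where "z = (\<lambda>n. x (fst (prod_decode n)) (snd (prod_decode n)))"
  have "range z \<subseteq> X" using tx(1) by (auto simp: z_def)
  moreover have "y i = eval_term (rename_vars (\<lambda>j. prod_encode (i, j)) (t i)) z" for i
    by (simp add: eval_rename_vars z_def tx(2))
  ultimately show ?thesis by (intro exI[of _ "\<lambda>i. rename_vars (\<lambda>j. prod_encode (i, j)) (t i)"] exI[of _ z]) simp
qed

lemma gen_field_eval_term: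
  assumes X: "X \<noteq> {}" and y: "y \<in> gen_field X"
  shows "\<exists>t x. range x \<subseteq> X \<and> y = eval_term t x"
proof -
  define K where "K = {y. \<exists>t x. range x \<subseteq> X \<and> y = eval_term t x}"
  have KI: "eval_term t x \<in> K" if "range x \<subseteq> X" for t x using that by (auto simp: K_def)
  obtain a where a: "a \<in> X" using X by blast
  have const: "of_rat q \<in> K" for q using KI[of "\<lambda>_. a" "Const q"] a by simp
  have var: "b \<in> K" if "b \<in> X" for b using KI[of "\<lambda>_. b" "Var 0"] that by simp
  have bin: "u + v \<in> K \<and> u * v \<in> K" if uv: "u \<in> K" "v \<in> K" for u v
  proof -
    define y where "y = (\<lambda>i :: nat. if i = 0 then u else v)"
    have "\<exists>t x. range x \<subseteq> X \<and> y i = eval_term t x" for i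
      using uv by (simp add: y_def K_def)
    then obtain s z where sz: "range z \<subseteq> X" "\<forall>i. y i = eval_term (s i) z"
      using common_assignment[of X y] by blast
    then have "u = eval_term (s 0) z" "v = eval_term (s 1) z" by (metis y_def, metis y_def zero_neq_one)
    then show ?thesis using KI[OF sz(1), of "Add (s 0) (s 1)"] KI[OF sz(1), of "Mul (s 0) (s 1)"] by simp
  qed
  have un: "- u \<in> K \<and> inverse u \<in> K" if "u \<in> K" for u
  proof -
    obtain t x where tx: "range x \<subseteq> X" "u = eval_term t x" using \<open>u \<in> K\<close> by (auto simp: K_def)
    have "inverse u \<in> K"
    proof (cases "u = 0")
      case True
      then show ?thesis using that by simp
    next
      case False
      \<comment> \<open>For this \<open>m\<close> the square of \<open>u\<close> exceeds the cutoff,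
        and the truncated inverse is exact.\<close>
      then obtain m where "inverse (real (Suc m)) < u\<^sup>2" using reals_Archimedean[of "u\<^sup>2"] by auto
      then have "eval_term (Inv m t) x = inverse u"
        using False by (simp add: tx(2)[symmetric] max_def inverse_eq_divide power2_eq_square)
      then show ?thesis using KI[OF tx(1), of "Inv m t"] by simp
    qed
    then show ?thesis using KI[OF tx(1), of "Neg t"] tx(2) by simp
  qed
  have "is_subfield K"
    unfolding is_subfield_def using const[of 0] const[of 1] bin un by simp
  moreover have "\<rat> \<union> X \<subseteq> K" using const var by (auto simp: Rats_def)
  ultimately have "gen_field X \<subseteq> K" by (rule gen_field_minimal[rotated])
  then show ?thesis using y by (auto simp: K_def)
qed

text \<open>Each \<open>k\<close>-tuple of terms maps a finite power of \<open>X\<close>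
  continuously into the power of the field. There are countably many such tuples, and their images
  cover.\<close>

lemma powers_of_field_bounded:
  fixes X :: "'a :: topological_space set" and \<phi> :: "'a \<Rightarrow> real"
  assumes F: "is_semifilter F" and R: "small_additive F R"
    and X: "X \<noteq> {}" and \<phi>: "continuous_on X \<phi>"
    and powers: "\<And>(I :: nat set) (\<Psi> :: (nat \<Rightarrow> 'a) \<Rightarrow> nat \<Rightarrow> nat). finite I \<Longrightarrow>
       continuous_map (product_topology (\<lambda>_. top_of_set X) I) euclidean \<Psi> \<Longrightarrow>
       bounded_wrt R (\<Psi> ` PiE I (\<lambda>_. X))"
    and \<Psi>: "continuous_map (finite_power k (gen_field (\<phi> ` X))) euclidean \<Psi>"
  shows "bounded_wrt R (\<Psi> ` topspace (finite_power k (gen_field (\<phi> ` X))))"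
proof -
  let ?K = "gen_field (\<phi> ` X)"
  define vars where "vars = (\<lambda>ts. \<Union>t\<in>set ts. term_vars t)"
  define E where "E = (\<lambda>ts x. \<lambda>j\<in>{..<k}. eval_term (ts ! j) (\<lambda>i. \<phi> (x i)))"
  define A where "A = {ts :: field_term list. length ts = k}"
  have finI: "finite (vars ts)" for ts by (simp add: vars_def finite_term_vars)
  have cont: "continuous_map (product_topology (\<lambda>_. top_of_set X) (vars ts)) (finite_power k ?K) (E ts)"
    if ts: "ts \<in> A" for ts
    unfolding finite_power_def
  proof (rule iffD2[OF continuous_map_componentwise], intro conjI ballI)
    let ?P = "product_topology (\<lambda>_. top_of_set X) (vars ts)"
    show "E ts ` topspace ?P \<subseteq> extensional {..<k}" by (auto simp: E_def)
    fix j assume j: "j \<in> {..<k}"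
    then have "ts ! j \<in> set ts" using ts by (simp add: A_def)
    then have sub: "term_vars (ts ! j) \<subseteq> vars ts" by (auto simp: vars_def)
    have "continuous_map ?P euclideanreal (\<lambda>x. eval_term (ts ! j) (\<lambda>i. \<phi> (x i)))"
    proof (rule continuous_map_eval_term)
      fix i assume "i \<in> term_vars (ts ! j)"
      then have "continuous_map ?P (top_of_set X) (\<lambda>x. x i)"
        by (intro continuous_map_product_projection) (use sub in blast)
      moreover have "continuous_map (top_of_set X) euclideanreal \<phi>" using \<phi> by simp
      ultimately show "continuous_map ?P euclideanreal (\<lambda>x. \<phi> (x i))"
        using continuous_map_compose[of ?P "top_of_set X" "\<lambda>x. x i" euclideanreal \<phi>] by (simp add: comp_def)
    qed
    moreover have "eval_term (ts ! j) (\<lambda>i. \<phi> (x i)) \<in> ?K" if x: "x \<in> topspace ?P" for x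
    proof (rule subfield_eval_term[OF is_subfield_gen_field])
      show "\<rat> \<subseteq> ?K" using gen_field_superset by blast
      fix i assume "i \<in> term_vars (ts ! j)"
      then have "x i \<in> X" using sub x by (auto simp: PiE_iff)
      then show "\<phi> (x i) \<in> ?K" by (intro subsetD[OF gen_field_superset]) simp
    qed
    ultimately show "continuous_map ?P (top_of_set ?K) (\<lambda>x. E ts x j)"
      using j by (simp add: E_def continuous_map_in_subtopology image_subset_iff)
  qed
  have "bounded_wrt R ((\<Psi> \<circ> E ts) ` PiE (vars ts) (\<lambda>_. X))" if "ts \<in> A" for ts
    using powers[OF finI continuous_map_compose[OF cont[OF that] \<Psi>]] .
  then have "bounded_wrt R (\<Union>ts\<in>A. (\<Psi> \<circ> E ts) ` PiE (vars ts) (\<lambda>_. X))"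
    by (rule bounded_small_UN[OF R countable_small[OF F], rotated]) (assumption, rule countableI_type)
  moreover have "\<Psi> ` topspace (finite_power k ?K) \<subseteq> (\<Union>ts\<in>A. (\<Psi> \<circ> E ts) ` PiE (vars ts) (\<lambda>_. X))"
  proof (rule image_subsetI)
    fix y assume "y \<in> topspace (finite_power k ?K)"
    then have y: "y \<in> PiE {..<k} (\<lambda>_. ?K)" by (simp add: finite_power_def)
    \<comment> \<open>Padding with 0, a member of the field, gives a full sequence as
      \<open>common_assignment\<close> expects.\<close>
    define y' where "y' = (\<lambda>i. if i < k then y i else 0)"
    have "y' i \<in> ?K" for i
      using y is_subfield_gen_field[of "\<phi> ` X"] by (auto simp: y'_def PiE_iff is_subfield_def)
    then have "\<exists>t x. range x \<subseteq> \<phi> ` X \<and> y' i = eval_term t x" for i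
      using X by (intro gen_field_eval_term) auto
    then obtain s z where sz: "range z \<subseteq> \<phi> ` X" "\<forall>i. y' i = eval_term (s i) z"
      using common_assignment[of "\<phi> ` X" y'] by blast
    then have "\<forall>i. \<exists>w. w \<in> X \<and> z i = \<phi> w" by blast
    then obtain w where w: "\<forall>i. w i \<in> X \<and> z i = \<phi> (w i)" by (rule choice[THEN exE])
    define ts where "ts = map s [0..<k]"
    have ts: "ts \<in> A" by (simp add: ts_def A_def)
    \<comment> \<open>Keeping only the finitely many variables of \<open>ts\<close> turns the
      infinite assignment into a point of a finite power.\<close>
    define x where "x = restrict w (vars ts)"
    have x: "x \<in> PiE (vars ts) (\<lambda>_. X)" using w by (simp add: x_def)
    have "y = E ts x"
    proof (rule extensionalityI[of _ "{..<k}"])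
      show "y \<in> extensional {..<k}" using y by (simp add: PiE_iff)
      show "E ts x \<in> extensional {..<k}" by (simp add: E_def)
      fix j assume j: "j \<in> {..<k}"
      then have tj: "ts ! j = s j" "term_vars (ts ! j) \<subseteq> vars ts" by (auto simp: ts_def vars_def)
      have "eval_term (s j) (\<lambda>i. \<phi> (x i)) = eval_term (s j) z"
        using tj w by (intro eval_term_cong) (auto simp: x_def)
      then show "y j = E ts x j" using j sz(2) tj(1) by (simp add: E_def y'_def split: if_splits)
    qed
    then have "\<Psi> y \<in> (\<Psi> \<circ> E ts) ` PiE (vars ts) (\<lambda>_. X)" using x by (intro image_eqI[of _ _ x]) simp_all
    then show "\<Psi> y \<in> (\<Union>ts\<in>A. (\<Psi> \<circ> E ts) ` PiE (vars ts) (\<lambda>_. X))" using ts by blast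
  qed
  ultimately show ?thesis by (rule bounded_wrt_subset)
qed

section \<open>Failure of \<open>\<sigma>\<close>-compactness\<close>

text \<open>The pair codes a finite sequence, namely the first \<open>snd p\<close> values of
  \<open>fst p\<close>.\<close>

definition cylinder :: "(nat \<Rightarrow> nat) set \<Rightarrow> (nat \<Rightarrow> nat) \<times> nat \<Rightarrow> (nat \<Rightarrow> nat) set" where
  "cylinder G p = {f \<in> G. \<forall>i<snd p. f i = fst p i}"

text \<open>As in the Cantor-Bendixson theorem: there are countably many finite sequences, so the
  countable cylinders have a countable union.\<close>

lemma countable_points_with_countable_cylinder:
  "countable {f \<in> G. \<exists>k. countable (cylinder G (f, k))}"
proof -
  define cl where "cl = (\<lambda>l. {f \<in> G. map f [0..<length l] = l})"
  have cl: "cl (map f [0..<k]) = cylinder G (f, k)" for f k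
    by (auto simp: cl_def cylinder_def)
  have "countable (\<Union>l\<in>{l. countable (cl l)}. cl l)"
    by (rule countable_UN) simp_all
  moreover have "{f \<in> G. \<exists>k. countable (cylinder G (f, k))} \<subseteq> (\<Union>l\<in>{l. countable (cl l)}. cl l)"
  proof
    fix f assume "f \<in> {f \<in> G. \<exists>k. countable (cylinder G (f, k))}"
    then obtain k where k: "f \<in> G" "countable (cylinder G (f, k))" by blast
    then have "f \<in> cl (map f [0..<k])" unfolding cl by (simp add: cylinder_def)
    moreover have "countable (cl (map f [0..<k]))" using k(2) by (simp only: cl)
    ultimately show "f \<in> (\<Union>l\<in>{l. countable (cl l)}. cl l)" by blast
  qed
  ultimately show ?thesis by (rule countable_subset[rotated])
qed

lemma uncountable_obtain_element:
  assumes "uncountable A"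
  obtains a where "a \<in> A"
  using assms by (cases "A = {}") auto

text \<open>Two distinct points outside the countable exceptional set have only uncountable
  cylinders, so it suffices to cut both beyond a place where they differ.\<close>

lemma split_uncountable_cylinder:
  assumes p: "uncountable (cylinder G p)"
  shows "\<exists>q :: bool \<Rightarrow> (nat \<Rightarrow> nat) \<times> nat.
    (\<forall>b. uncountable (cylinder G (q b)) \<and> snd p < snd (q b) \<and> (\<forall>i<snd p. fst (q b) i = fst p i)) \<and>
    snd (q True) = snd (q False) \<and> (\<exists>i<snd (q True). fst (q True) i \<noteq> fst (q False) i)"
proof -
  let ?N = "{f \<in> G. \<exists>k. countable (cylinder G (f, k))}"
  have unc: "uncountable (cylinder G p - ?N)"
    using p countable_points_with_countable_cylinder by (rule uncountable_minus_countable)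
  then obtain u where u: "u \<in> cylinder G p - ?N" by (rule uncountable_obtain_element)
  have "uncountable (cylinder G p - ?N - {u})"
    using unc by (rule uncountable_minus_countable) simp
  then obtain v where "v \<in> cylinder G p - ?N - {u}" by (rule uncountable_obtain_element)
  then have v: "v \<in> cylinder G p - ?N" "v \<noteq> u" by simp_all
  from v(2) obtain i where "v i \<noteq> u i" by (auto simp: fun_eq_iff)
  then have i: "u i \<noteq> v i" by simp
  define n where "n = max (Suc i) (Suc (snd p))"
  have "uncountable (cylinder G (u, n))" "uncountable (cylinder G (v, n))"
    using u v(1) by (auto simp: cylinder_def)
  moreover have "\<forall>j<snd p. u j = fst p j" "\<forall>j<snd p. v j = fst p j"
    using u v(1) by (auto simp: cylinder_def)
  moreover have "snd p < n" "i < n" by (auto simp: n_def)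
  ultimately show ?thesis
    using i by (intro exI[of _ "\<lambda>b. if b then (u, n) else (v, n)"]) auto
qed

text \<open>A Cantor scheme.  The bound exists because each level of the scheme is finite.\<close>
lemma uncountable_closed_contains_bounded_Cantor_set:
  fixes G :: "(nat \<Rightarrow> nat) set"
  assumes unc: "uncountable G"
    and closed: "\<And>f. (\<And>n. \<exists>f'\<in>G. \<forall>i<n. f' i = f i) \<Longrightarrow> f \<in> G"
  shows "\<exists>g \<Phi>. inj \<Phi> \<and> (\<forall>\<beta> :: nat \<Rightarrow> bool. \<Phi> \<beta> \<in> G \<and> (\<forall>n. \<Phi> \<beta> n \<le> g n))"
proof -
  define good where "good p \<longleftrightarrow> uncountable (cylinder G p)" for p
  define splits where "splits p q \<longleftrightarrow>
    (\<forall>b. good (q b) \<and> snd p < snd (q b) \<and> (\<forall>i<snd p. fst (q b) i = fst p i)) \<and>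
    snd (q True) = snd (q False) \<and> (\<exists>i<snd (q True). fst (q True) i \<noteq> fst (q False) i)"
    for p and q :: "bool \<Rightarrow> (nat \<Rightarrow> nat) \<times> nat"
  have "\<exists>q. splits p q" if "good p" for p
    unfolding splits_def good_def using that[unfolded good_def] by (rule split_uncountable_cylinder)
  then obtain e where splits: "\<And>p. good p \<Longrightarrow> splits p (e p)" by metis
  note e = splits[unfolded splits_def]
  \<comment> \<open>The root has length 0, so its cylinder is all of \<open>G\<close>; the bit
    \<open>\<beta> k\<close> selects the child of the node at level \<open>k\<close>.\<close>
  define node where "node \<beta> = rec_nat (\<lambda>_. 0 :: nat, 0 :: nat) (\<lambda>k p. e p (\<beta> k))" for \<beta> :: "nat \<Rightarrow> bool"
  have node_0: "node \<beta> 0 = (\<lambda>_. 0, 0)" and node_Suc: "node \<beta> (Suc k) = e (node \<beta> k) (\<beta> k)" for \<beta> k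
    by (simp_all add: node_def)
  have good: "good (node \<beta> k)" for \<beta> k
  proof (induction k)
    case 0
    then show ?case using unc by (simp add: node_0 good_def cylinder_def)
  next
    case (Suc k)
    then show ?case using e[of "node \<beta> k"] by (simp add: node_Suc)
  qed
  have node_step: "snd (node \<beta> k) < snd (node \<beta> (Suc k))"
    "i < snd (node \<beta> k) \<Longrightarrow> fst (node \<beta> (Suc k)) i = fst (node \<beta> k) i" for \<beta> k i
    using e[OF good[of \<beta> k]] by (simp_all add: node_Suc)
  have len: "k \<le> snd (node \<beta> k)" for \<beta> k
  proof (induction k)
    case (Suc k)
    then show ?case using node_step(1)[of \<beta> k] by simp
  qed simp
  have snd_mono: "snd (node \<beta> k) \<le> snd (node \<beta> l)" if "k \<le> l" for \<beta> k l
    by (rule lift_Suc_mono_le[of "\<lambda>k. snd (node \<beta> k)", OF less_imp_le[OF node_step(1)] that])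
  have coherent: "fst (node \<beta> l) i = fst (node \<beta> k) i" if "k \<le> l" "i < snd (node \<beta> k)" for \<beta> k l i
    using that(1)
  proof (induction rule: dec_induct)
    case (step l)
    have "i < snd (node \<beta> l)" using that(2) snd_mono[OF step(1), of \<beta>] by simp
    then show ?case using step.IH node_step(2) by simp
  qed simp
  \<comment> \<open>A node of level \<open>n + 1\<close> has length at least \<open>n + 1\<close>,
    so it already fixes the value at \<open>n\<close>.\<close>
  define \<Phi> where "\<Phi> \<beta> n = fst (node \<beta> (Suc n)) n" for \<beta> n
  have \<Phi>: "\<Phi> \<beta> i = fst (node \<beta> k) i" if "i < snd (node \<beta> k)" for \<beta> k i
  proof -
    have "i < snd (node \<beta> (Suc i))" using len[of "Suc i" \<beta>] by simp
    then show ?thesis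
      unfolding \<Phi>_def using coherent[of k "Suc i" i \<beta>] coherent[of "Suc i" k i \<beta>] that
      by (cases "k \<le> Suc i") auto
  qed
  have in_G: "\<Phi> \<beta> \<in> G" for \<beta>
  proof (rule closed)
    fix n
    obtain f where "f \<in> cylinder G (node \<beta> n)"
      using good[of \<beta> n] unfolding good_def by (rule uncountable_obtain_element)
    then have f: "f \<in> G" "\<forall>i<snd (node \<beta> n). f i = fst (node \<beta> n) i"
      by (simp_all add: cylinder_def)
    have "\<forall>i<n. f i = \<Phi> \<beta> i" using f(2) \<Phi>[of _ \<beta> n] len[of n \<beta>] by auto
    then show "\<exists>f'\<in>G. \<forall>i<n. f' i = \<Phi> \<beta> i" using f(1) by blast
  qed
  have "inj \<Phi>"
  proof (rule injI, rule ccontr)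
    fix \<beta> \<gamma> assume eq: "\<Phi> \<beta> = \<Phi> \<gamma>" and "\<beta> \<noteq> \<gamma>"
    then have ex: "\<exists>k. \<beta> k \<noteq> \<gamma> k" by auto
    \<comment> \<open>The paths share their node at level \<open>k\<close> and then enter its two
      different children, which differ below their common length.\<close>
    define k where "k = (LEAST k. \<beta> k \<noteq> \<gamma> k)"
    have k: "\<beta> k \<noteq> \<gamma> k" unfolding k_def by (rule LeastI_ex[OF ex])
    have below: "\<beta> j = \<gamma> j" if "j < k" for j
      using not_less_Least[of j "\<lambda>k. \<beta> k \<noteq> \<gamma> k"] that by (auto simp: k_def)
    have "j \<le> k \<Longrightarrow> node \<beta> j = node \<gamma> j" for j
      by (induction j) (auto simp: node_0 node_Suc below)
    then have nk: "node \<gamma> k = node \<beta> k" by simp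
    let ?q = "e (node \<beta> k)"
    obtain i where i: "i < snd (?q True)" "snd (?q True) = snd (?q False)" "fst (?q True) i \<noteq> fst (?q False) i"
      using e[OF good[of \<beta> k]] by blast
    have "\<Phi> \<beta> i = fst (?q (\<beta> k)) i"
      using \<Phi>[of i \<beta> "Suc k"] i by (cases "\<beta> k") (simp_all add: node_Suc)
    moreover have "\<Phi> \<gamma> i = fst (?q (\<gamma> k)) i"
      using \<Phi>[of i \<gamma> "Suc k"] i by (cases "\<gamma> k") (simp_all add: node_Suc nk)
    ultimately show False using eq k i(3) by (cases "\<beta> k"; cases "\<gamma> k") auto
  qed
  moreover have fin: "finite (range (\<lambda>\<beta>. node \<beta> k))" for k
  proof (induction k)
    case 0
    then show ?case by (simp add: node_0)
  next
    case (Suc k)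
    have "range (\<lambda>\<beta>. node \<beta> (Suc k)) \<subseteq> (\<lambda>(p, b). e p b) ` (range (\<lambda>\<beta>. node \<beta> k) \<times> UNIV)"
      by (force simp: node_Suc)
    then show ?case by (rule finite_subset) (use Suc in simp)
  qed
  moreover have "\<Phi> \<beta> n \<le> Max ((\<lambda>p. fst p n) ` range (\<lambda>\<beta>. node \<beta> (Suc n)))" for \<beta> n
    unfolding \<Phi>_def using fin[of "Suc n"] by (intro Max_ge) auto
  ultimately show ?thesis
    using in_G by (intro exI[of _ "\<lambda>n. Max ((\<lambda>p. fst p n) ` range (\<lambda>\<beta>. node \<beta> (Suc n)))"] exI[of _ \<Phi>]) blast
qed

lemma b_scale_uncountable:
  assumes "is_semifilter F" and "is_b_scale F S"
  shows "uncountable S"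
proof
  assume "countable S"
  from countable_small[OF assms(1) this] have "bounded_wrt (le_mod F) (id ` S)"
    unfolding small_wrt_def by blast
  then show False using assms(2) by (simp add: is_b_scale_def)
qed

context
  includes cardinal_syntax
begin

text \<open>A function is coded by the characteristic function of its graph.\<close>

lemma card_of_Baire_le_Cantor: "|UNIV :: (nat \<Rightarrow> nat) set| \<le>o |UNIV :: (nat \<Rightarrow> bool) set|"
proof -
  let ?i = "\<lambda>(f :: nat \<Rightarrow> nat) k. f (fst (prod_decode k)) = snd (prod_decode k)"
  have "inj ?i"
  proof (rule injI)
    fix f g assume "?i f = ?i g"
    then have "?i f (prod_encode (n, f n)) = ?i g (prod_encode (n, f n))" for n by metis
    then show "f = g" by (auto simp: fun_eq_iff)
  qed
  then show ?thesis using card_of_ordLeq[of UNIV UNIV] by blast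
qed

text \<open>
  A bounded subset of the scale has cardinality less than \<open>\<bb>(F)\<close>, hence less than the continuum,
  so it cannot contain a Cantor set.
\<close>
lemma b_scale_not_sigma_compact:
  fixes A :: "nat \<Rightarrow> (nat \<Rightarrow> enat) set"
  assumes F: "is_semifilter F" and S: "is_b_scale F S"
    and A: "\<And>n. compact (A n)" and union: "ext_embed ` S \<union> ext_incr_inf = (\<Union>n. A n)"
  shows False
proof -
  \<comment> \<open>The finite-valued points of a compact piece. They belong to \<open>S\<close>,
    since members of \<open>ext_incr_inf\<close> take the value \<open>\<infinity>\<close>, and they
    form a closed subset of the Baire space.\<close>
  define G where "G n = {f. ext_embed f \<in> A n}" for n
  have inj: "inj ext_embed" by (auto simp: inj_def ext_embed_def fun_eq_iff)
  have "f \<in> S" if "f \<in> G n" for f n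
  proof -
    have "ext_embed f \<in> ext_embed ` S \<union> ext_incr_inf" using that union by (auto simp: G_def)
    moreover have "ext_embed f \<notin> ext_incr_inf" by (simp add: ext_incr_inf_def ext_embed_def)
    ultimately show ?thesis using inj by (simp add: inj_image_mem_iff)
  qed
  then have GS: "G n \<subseteq> S" for n by blast
  have "S \<subseteq> (\<Union>n. G n)" using union by (auto simp: G_def)
  then have "uncountable (\<Union>n. G n)" using b_scale_uncountable[OF F S] countable_subset by blast
  then obtain n where n: "uncountable (G n)" by (metis countable_UN countableI_type)
  have closedG: "f \<in> G n" if f: "\<And>k. \<exists>f'\<in>G n. \<forall>i<k. f' i = f i" for f
  proof -
    obtain u where u: "\<And>k. u k \<in> G n" "\<And>k i. i < k \<Longrightarrow> u k i = f i" using f by metis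
    have "(\<lambda>k. ext_embed (u k) i) \<longlonglongrightarrow> ext_embed f i" for i
    proof (rule tendsto_eventually)
      show "\<forall>\<^sub>F k in sequentially. ext_embed (u k) i = ext_embed f i"
        using eventually_gt_at_top[of i] by eventually_elim (simp add: ext_embed_def u(2))
    qed
    then have "limitin (product_topology (\<lambda>_. euclidean) UNIV) (\<lambda>k. ext_embed (u k)) (ext_embed f) sequentially"
      by (simp add: limitin_componentwise)
    then have "(\<lambda>k. ext_embed (u k)) \<longlonglongrightarrow> ext_embed f"
      by (simp add: euclidean_product_topology)
    moreover have "closed (A n)"
    proof -
      have "Hausdorff_space (euclidean :: enat topology)"
        unfolding Hausdorff_space_def disjnt_def by (metis hausdorff open_openin)
      then have "Hausdorff_space (euclidean :: (nat \<Rightarrow> enat) topology)"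
        unfolding euclidean_product_topology[symmetric] by (simp add: Hausdorff_space_product_topology)
      then have "closedin euclidean (A n)" using A by (intro compactin_imp_closedin) simp_all
      then show ?thesis by simp
    qed
    moreover have "\<forall>k. ext_embed (u k) \<in> A n" using u(1) by (simp add: G_def)
    ultimately show ?thesis unfolding G_def by (auto intro: closed_sequentially)
  qed
  obtain g \<Phi> where \<Phi>: "inj \<Phi>" "\<forall>\<beta> :: nat \<Rightarrow> bool. \<Phi> \<beta> \<in> G n \<and> (\<forall>n. \<Phi> \<beta> n \<le> g n)"
    using uncountable_closed_contains_bounded_Cantor_set[OF n closedG] by blast
  \<comment> \<open>Nothing pointwise below \<open>g\<close> can dominate \<open>s\<close> modulo
    \<open>F\<close>, so the whole Cantor set lies among the few exceptions for
    \<open>s\<close>.\<close>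
  obtain s where s: "s \<in> S" "\<not> le_mod F s g"
    using S unfolding is_b_scale_def bounded_wrt_def by blast
  have "range \<Phi> \<subseteq> {t \<in> S. \<not> le_mod F s t}"
  proof
    fix t assume "t \<in> range \<Phi>"
    then have t: "t \<in> S" "\<And>n. t n \<le> g n" using \<Phi>(2) GS by auto
    have "\<not> le_mod F s t" using le_mod_mono[OF F, of s t s g] t(2) s(2) by auto
    then show "t \<in> {t \<in> S. \<not> le_mod F s t}" using t(1) by simp
  qed
  then have "|UNIV :: (nat \<Rightarrow> bool) set| \<le>o |{t \<in> S. \<not> le_mod F s t}|"
    using \<Phi>(1) card_of_ordLeq[of UNIV "{t \<in> S. \<not> le_mod F s t}"] by blast
  also have "|{t \<in> S. \<not> le_mod F s t}| <o b_number F" by (rule b_scale_below_card[OF F S s(1)])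
  also have "b_number F \<le>o |UNIV :: (nat \<Rightarrow> nat) set|"
  proof -
    obtain Y where "b_number F = |Y|" using b_number_minimal[OF F] by blast
    then show ?thesis using card_of_mono1[of Y UNIV] by simp
  qed
  also have "|UNIV :: (nat \<Rightarrow> nat) set| \<le>o |UNIV :: (nat \<Rightarrow> bool) set|" by (rule card_of_Baire_le_Cantor)
  finally show False by (simp add: ordLess_irreflexive)
qed

end

section \<open>The field generated by a scale\<close>

lemma compact_UNIV_Cantor: "compact (UNIV :: (nat \<Rightarrow> bool) set)"
proof -
  have "compactin (product_topology (\<lambda>_ :: nat. euclidean :: bool topology) UNIV) (PiE UNIV (\<lambda>_. UNIV))"
    unfolding compactin_PiE by (simp add: finite_imp_compact)
  then show ?thesis by (simp add: euclidean_product_topology PiE_UNIV_domain)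
qed

theorem theorem6p1:
  fixes C X :: "real set"
    and \<phi> :: "(nat \<Rightarrow> enat) \<Rightarrow> real" and \<psi> :: "real \<Rightarrow> nat \<Rightarrow> enat"
    and F :: "nat set set" and S :: "(nat \<Rightarrow> nat) set"
  assumes "C homeomorphic (UNIV :: (nat \<Rightarrow> bool) set)"
    and "alg_indep_over_rat C"
    and "homeomorphism ext_incr C \<phi> \<psi>"
    and "is_filter_nat F"
    and "is_b_scale F S"
    and "X = \<phi> ` (ext_embed ` S \<union> ext_incr_inf)"
  shows "(\<forall>k. satisfies_B (positive_sets F) (finite_power k (gen_field X))) \<and>
         (is_ultrafilter_nat F \<longrightarrow> (\<forall>k. satisfies_B F (finite_power k (gen_field X)))) \<and>
         (feeble F \<longrightarrow> (\<forall>k. hurewicz (finite_power k (gen_field X)))) \<and>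
         (\<forall>P. hereditary_closed P \<and> \<not> P X \<longrightarrow> \<not> P (gen_field X)) \<and>
         \<not> sigma_compact (gen_field X)"
proof -
  let ?X = "ext_embed ` S \<union> ext_incr_inf"
  have sF: "is_semifilter F" using assms(4) by (rule filter_imp_semifilter)
  have "compact C"
    using homeomorphic_compactness[OF assms(1)] compact_UNIV_Cantor by blast
  have cont: "continuous_on ext_incr \<phi>" "continuous_on C \<psi>" and im: "\<phi> ` ext_incr = C" "\<psi> ` C = ext_incr"
    and inv: "\<And>x. x \<in> ext_incr \<Longrightarrow> \<psi> (\<phi> x) = x"
    using assms(3) by (auto simp: homeomorphism_def)
  have comp: "compact ext_incr" using compact_continuous_image[OF cont(2) \<open>compact C\<close>] im(2) by simp
  have sub: "?X \<subseteq> ext_incr" using b_scale_subset_ext_incr[OF assms(5)] .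
  have XC: "X \<subseteq> C" using sub im(1) assms(6) by blast
  have "S \<noteq> {}" using b_scale_uncountable[OF sF assms(5)] by auto
  then have ne: "?X \<noteq> {}" by simp
  \<comment> \<open>Shared by the relation for positive sets and by \<open>le_star\<close>; the
    ultrafilter case reduces to the former.\<close>
  have bounded: "bounded_wrt R (\<Psi> ` topspace (finite_power k (gen_field X)))"
    if "small_additive F R" "scale_dominated F S R"
      and "continuous_map (finite_power k (gen_field X)) euclidean \<Psi>" for R k and \<Psi> :: "(nat \<Rightarrow> real) \<Rightarrow> nat \<Rightarrow> nat"
    using that(3) unfolding assms(6)
    by (intro powers_of_field_bounded[OF sF that(1) ne continuous_on_subset[OF cont(1) sub]]
        powers_of_scale_bounded[OF sF assms(5) that(1,2) comp countable_ext_incr_inf refl])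
  have B: "satisfies_B (positive_sets F) (finite_power k (gen_field X))" for k
    unfolding satisfies_B_def
    using bounded[OF small_additive_positive_sets[OF assms(4)] scale_dominated_positive_sets[OF assms(4,5)]] by blast
  moreover have "satisfies_B F (finite_power k (gen_field X))" if "is_ultrafilter_nat F" for k
    using B[of k] positive_sets_ultrafilter[OF that] by simp
  moreover have "hurewicz (finite_power k (gen_field X))" if "feeble F" for k
    unfolding hurewicz_def
    using bounded[OF small_additive_feeble[OF that] scale_dominated_feeble[OF assms(4,5) that]] by blast
  moreover have XK: "gen_field X \<inter> C = X" by (rule gen_field_Int_alg_indep[OF assms(2) XC])
  \<comment> \<open>\<open>X\<close> is the trace of the compact set \<open>C\<close> on the
    field.\<close>
  have "closedin (top_of_set (gen_field X)) X"
    using closedin_closed_Int[OF compact_imp_closed[OF \<open>compact C\<close>], of "gen_field X"] XK by simp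
  then have "\<not> P (gen_field X)" if "hereditary_closed P" "\<not> P X" for P
    using that unfolding hereditary_closed_def by blast
  moreover have "\<not> sigma_compact (gen_field X)"
  proof
    assume "sigma_compact (gen_field X)"
    then obtain A :: "nat \<Rightarrow> real set" where A: "\<And>n. compact (A n)" "gen_field X = (\<Union>n. A n)"
      unfolding sigma_compact_def by blast
    \<comment> \<open>The pieces are cut down to \<open>C\<close> and carried back by
      \<open>\<psi>\<close>; they cover exactly \<open>?X\<close> because the field meets
      \<open>C\<close> in \<open>X\<close>.\<close>
    have "compact (\<psi> ` (A n \<inter> C))" for n
      using A(1) \<open>compact C\<close> by (intro compact_continuous_image continuous_on_subset[OF cont(2)])
        (auto intro: compact_Int_closed compact_imp_closed)
    moreover have "?X = (\<Union>n. \<psi> ` (A n \<inter> C))"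
    proof -
      have "(\<lambda>x. \<psi> (\<phi> x)) ` ?X = (\<lambda>x. x) ` ?X"
        by (rule image_cong) (use inv sub in blast)+
      then have "\<psi> ` X = ?X" by (simp add: assms(6) image_image)
      moreover have "X = (\<Union>n. A n \<inter> C)" using XK A(2) by blast
      ultimately show ?thesis using image_UN[of \<psi> "\<lambda>n. A n \<inter> C" UNIV] by simp
    qed
    ultimately show False by (rule b_scale_not_sigma_compact[OF sF assms(5)])
  qed
  ultimately show ?thesis by blast
qed

end
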